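(* Let $(M,\varrho)$ be complete, let $(P_t)_{t>0}$ be strong Feller and absolutely continuous, let $d>0$, and assume that $$g_\lambda(x,y)\le c_6\,\varrho(x,y)^{2-d},\quad x,y\in M,$$ and $$\mu(B(x,r))\le c_7\,r^d,\quad x\in M,\ r>0,$$ with positive constants $c_6$ and $c_7$. Let $\Sigma\subset M$ be a closed set. (i) If $d>4$ and $\varepsilon>0$, then $\mathrm{Cap}_{2,2}(\Sigma)=0$ implies $\mathcal{H}^{d-4+\varepsilon}(\Sigma)=0$. If $d=4$, $M$ is bounded and $h$ is a Hausdorff function satisfying $\int_0^1(-\log r)\,dh(r)<+\infty$, then $\mathrm{Cap}_{2,2}(\Sigma)=0$ implies $\mathcal{H}^h(\Sigma)=0$. (ii) Suppose that $1<p<+\infty$, $d>2p$ and $\varepsilon>0$. For $p\ne2$ assume in addition that $\mu(B(x,r))\ge\frac{1}{c_7}r^d$ for all $x\in M$, $r>0$. Then $\mathrm{Cap}_{2,p}(\Sigma)=0$ implies $\mathcal{H}^{d-2p+\varepsilon}(\Sigma)=0$.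
   Context: Setup: $(M,\varrho)$ is a locally compact separable metric space and $\mu$ is a nonnegative Radon measure on $M$ with full support; $L^p(M):=L^p(M,\mu)$. $(\mathcal{L},\mathcal{D}(\mathcal{L}))$ is a non-positive definite densely defined self-adjoint operator on $L^2(M)$ whose quadratic form $(\mathcal{E},\mathcal{D}(\mathcal{E}))$, $\mathcal{E}(f,g)=-\langle\mathcal{L}f,g\rangle_{L^2(M)}$, is a regular, strongly local Dirichlet form admitting a carré du champ (i.e. there is a nonnegative definite bilinear $L^1(M)$-valued map $\Gamma$ on $\mathcal{D}(\mathcal{E})\cap L^\infty(M)$ with $\frac12\{\mathcal{E}(fh,g)+\mathcal{E}(f,gh)-\mathcal{E}(fg,h)\}=\int_Mh\,\Gamma(f,g)d\mu$). $(P_t)_{t>0}$ is the symmetric Markov semigroup generated by $\mathcal{L}$. $(P_t)_{t>0}$ is strong Feller if $P_tf\in C_b(M)$ (bounded continuous functions) for all $t>0$, $f\in L^\infty(M)$; it is absolutely continuous if moreover for all $t>0$, $x\in M$ the measure $P_t(x,A):=P_t\mathbf{1}_A(x)$ has a density $p_{t,x}$ with respect to $\mu$. Then $p_t(x,y):=\int_Mp_{t/2,x}(z)p_{t/2,y}(z)\mu(dz)$ is the unique heat kernel of $(P_t)_{t>0}$. For fixed $\lambda>0$ set $g_\lambda(x,y):=\int_0^\infty e^{-\lambda t}p_t(x,y)\,dt\in[0,+\infty]$ and $G_\lambda f(x):=\int_Mg_\lambda(x,y)f(y)\mu(dy)$ for nonnegative measurable $f$. For $d>2$ one reads $\varrho(x,x)^{2-d}=+\infty$.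 $\mathrm{Cap}_{2,p}(E):=\inf\{\|f\|_{L^p(M)}^p:f\in L^p(M),\ f\ge0,\ G_\lambda f(x)\ge1\text{ for all }x\in E\}$ for $E\subset M$ ($+\infty$ if no such $f$ exists). Hausdorff measures: a Hausdorff function is a non-decreasing and right-continuous $h:[0,+\infty)\to[0,+\infty)$, strictly positive on $(0,+\infty)$, and with $h(2r)\le c\,h(r)$, $r>0$, for some constant $c>1$. $\mathcal{H}^h(E):=\lim_{\delta\to0}\inf\sum_ih(\mathrm{diam}(E_i))$, the infimum over countable covers of $E$ by sets $E_i$ with $\mathrm{diam}(E_i)<\delta$; $\mathcal{H}^s$, $s\ge0$, is the case $h(r)=r^s$. *)

theory Defs
  imports "HOL-Analysis.Analysis"
begin

section \<open>Measures and Lebesgue spaces\<close>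

definition radon_measure :: "'a::metric_space measure \<Rightarrow> bool" where
  "radon_measure \<mu> \<longleftrightarrow>
     sets \<mu> = sets borel \<and>
     (\<forall>K. compact K \<longrightarrow> emeasure \<mu> K < \<infinity>) \<and>
     (\<forall>A\<in>sets \<mu>. emeasure \<mu> A = (SUP K\<in>{K. K \<subseteq> A \<and> compact K}. emeasure \<mu> K))"

definition full_support :: "'a::metric_space measure \<Rightarrow> bool" where
  "full_support \<mu> \<longleftrightarrow> (\<forall>U. open U \<and> U \<noteq> {} \<longrightarrow> 0 < emeasure \<mu> U)"

text \<open>
  Elements of the spaces $L^p(\mu)$ are represented by Borel functions; almost everywhere equal
  functions are not identified.  Therefore every operator and form below is required to respect
  almost everywhere equality, and every domain to be closed under it.
\<close>

definition Lp_space :: "'a measure \<Rightarrow> real \<Rightarrow> ('a \<Rightarrow> real) set" where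
  "Lp_space \<mu> p = {f \<in> borel_measurable \<mu>. integrable \<mu> (\<lambda>x. \<bar>f x\<bar> powr p)}"

definition Linf_space :: "'a measure \<Rightarrow> ('a \<Rightarrow> real) set" where
  "Linf_space \<mu> = {f \<in> borel_measurable \<mu>. \<exists>C. AE x in \<mu>. \<bar>f x\<bar> \<le> C}"

definition Lp_norm :: "'a measure \<Rightarrow> real \<Rightarrow> ('a \<Rightarrow> real) \<Rightarrow> real" where
  "Lp_norm \<mu> p f = (\<integral>x. \<bar>f x\<bar> powr p \<partial>\<mu>) powr (1 / p)"

definition L2_inner :: "'a measure \<Rightarrow> ('a \<Rightarrow> real) \<Rightarrow> ('a \<Rightarrow> real) \<Rightarrow> real" where
  "L2_inner \<mu> f g = (\<integral>x. f x * g x \<partial>\<mu>)"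

definition ae_eq :: "'a measure \<Rightarrow> ('a \<Rightarrow> real) \<Rightarrow> ('a \<Rightarrow> real) \<Rightarrow> bool" where
  "ae_eq \<mu> f g \<longleftrightarrow> (AE x in \<mu>. f x = g x)"

definition L2_subspace :: "'a measure \<Rightarrow> ('a \<Rightarrow> real) set \<Rightarrow> bool" where
  "L2_subspace \<mu> D \<longleftrightarrow>
     D \<subseteq> Lp_space \<mu> 2 \<and> (\<lambda>x. 0) \<in> D \<and>
     (\<forall>f\<in>D. \<forall>g\<in>D. \<forall>a b. (\<lambda>x. a * f x + b * g x) \<in> D) \<and>
     (\<forall>f\<in>D. \<forall>g\<in>borel_measurable \<mu>. ae_eq \<mu> f g \<longrightarrow> g \<in> D)"

definition L2_dense :: "'a measure \<Rightarrow> ('a \<Rightarrow> real) set \<Rightarrow> bool" where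
  "L2_dense \<mu> D \<longleftrightarrow>
     (\<forall>f\<in>Lp_space \<mu> 2. \<forall>e>0. \<exists>g\<in>D. Lp_norm \<mu> 2 (\<lambda>x. f x - g x) < e)"

section \<open>Self-adjoint operators and their quadratic forms\<close>

definition L2_operator ::
  "'a measure \<Rightarrow> ('a \<Rightarrow> real) set \<Rightarrow> (('a \<Rightarrow> real) \<Rightarrow> ('a \<Rightarrow> real)) \<Rightarrow> bool" where
  "L2_operator \<mu> D A \<longleftrightarrow>
     L2_subspace \<mu> D \<and>
     (\<forall>f\<in>D. A f \<in> Lp_space \<mu> 2) \<and>
     (\<forall>f\<in>D. \<forall>g\<in>D. ae_eq \<mu> f g \<longrightarrow> ae_eq \<mu> (A f) (A g)) \<and>
     (\<forall>f\<in>D. \<forall>g\<in>D. \<forall>a b.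
        ae_eq \<mu> (A (\<lambda>x. a * f x + b * g x)) (\<lambda>x. a * A f x + b * A g x))"

text \<open>The last conjunct says that the graph of the operator equals that of its adjoint.\<close>

definition self_adjoint_operator ::
  "'a measure \<Rightarrow> ('a \<Rightarrow> real) set \<Rightarrow> (('a \<Rightarrow> real) \<Rightarrow> ('a \<Rightarrow> real)) \<Rightarrow> bool" where
  "self_adjoint_operator \<mu> D A \<longleftrightarrow>
     L2_operator \<mu> D A \<and> L2_dense \<mu> D \<and>
     (\<forall>g\<in>Lp_space \<mu> 2. \<forall>h\<in>Lp_space \<mu> 2.
        (g \<in> D \<and> ae_eq \<mu> (A g) h) \<longleftrightarrow> (\<forall>f\<in>D. L2_inner \<mu> (A f) g = L2_inner \<mu> f h))"

definition nonpositive_operator ::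
  "'a measure \<Rightarrow> ('a \<Rightarrow> real) set \<Rightarrow> (('a \<Rightarrow> real) \<Rightarrow> ('a \<Rightarrow> real)) \<Rightarrow> bool" where
  "nonpositive_operator \<mu> D A \<longleftrightarrow> (\<forall>f\<in>D. L2_inner \<mu> (A f) f \<le> 0)"

text \<open>
  The quadratic form of a non-positive self-adjoint operator $A$ is the closure of
  $(f,g) \mapsto -\langle Af,g\rangle$, given on the domain of $A$.  The sequences below are those
  which define it: convergent in $L^2$ and Cauchy for the form.
\<close>

definition form_approx ::
  "'a measure \<Rightarrow> ('a \<Rightarrow> real) set \<Rightarrow> (('a \<Rightarrow> real) \<Rightarrow> ('a \<Rightarrow> real))
     \<Rightarrow> (nat \<Rightarrow> 'a \<Rightarrow> real) \<Rightarrow> ('a \<Rightarrow> real) \<Rightarrow> bool" where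
  "form_approx \<mu> D A u f \<longleftrightarrow>
     (\<forall>n. u n \<in> D) \<and>
     (\<lambda>n. Lp_norm \<mu> 2 (\<lambda>x. u n x - f x)) \<longlonglongrightarrow> 0 \<and>
     (\<forall>e>0. \<exists>N. \<forall>m\<ge>N. \<forall>n\<ge>N.
        - L2_inner \<mu> (A (\<lambda>x. u m x - u n x)) (\<lambda>x. u m x - u n x) < e)"

definition form_domain ::
  "'a measure \<Rightarrow> ('a \<Rightarrow> real) set \<Rightarrow> (('a \<Rightarrow> real) \<Rightarrow> ('a \<Rightarrow> real)) \<Rightarrow> ('a \<Rightarrow> real) set" where
  "form_domain \<mu> D A = {f \<in> Lp_space \<mu> 2. \<exists>u. form_approx \<mu> D A u f}"

definition quadratic_form ::
  "'a measure \<Rightarrow> ('a \<Rightarrow> real) set \<Rightarrow> (('a \<Rightarrow> real) \<Rightarrow> ('a \<Rightarrow> real))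
     \<Rightarrow> ('a \<Rightarrow> real) \<Rightarrow> ('a \<Rightarrow> real) \<Rightarrow> real" where
  "quadratic_form \<mu> D A f g =
     (THE c. \<forall>u v. form_approx \<mu> D A u f \<and> form_approx \<mu> D A v g \<longrightarrow>
        (\<lambda>n. - L2_inner \<mu> (A (u n)) (v n)) \<longlonglongrightarrow> c)"

section \<open>Dirichlet forms\<close>

definition form_norm ::
  "'a measure \<Rightarrow> (('a \<Rightarrow> real) \<Rightarrow> ('a \<Rightarrow> real) \<Rightarrow> real) \<Rightarrow> ('a \<Rightarrow> real) \<Rightarrow> real" where
  "form_norm \<mu> E f = sqrt (E f f + L2_inner \<mu> f f)"

definition dirichlet_form ::
  "'a measure \<Rightarrow> ('a \<Rightarrow> real) set \<Rightarrow> (('a \<Rightarrow> real) \<Rightarrow> ('a \<Rightarrow> real) \<Rightarrow> real) \<Rightarrow> bool" where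
  "dirichlet_form \<mu> D E \<longleftrightarrow>
     L2_subspace \<mu> D \<and> L2_dense \<mu> D \<and>
     (\<forall>f\<in>D. \<forall>g\<in>D. E f g = E g f) \<and>
     (\<forall>f\<in>D. \<forall>g\<in>D. \<forall>h\<in>D. \<forall>a b. E (\<lambda>x. a * f x + b * g x) h = a * E f h + b * E g h) \<and>
     (\<forall>f\<in>D. \<forall>g\<in>D. \<forall>h\<in>D. ae_eq \<mu> f g \<longrightarrow> E f h = E g h) \<and>
     (\<forall>f\<in>D. 0 \<le> E f f) \<and>
     \<comment> \<open>closedness\<close>
     (\<forall>u. (\<forall>n. u n \<in> D) \<and>
          (\<forall>e>0. \<exists>N. \<forall>m\<ge>N. \<forall>n\<ge>N. form_norm \<mu> E (\<lambda>x. u m x - u n x) < e) \<longrightarrow>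
          (\<exists>f\<in>D. (\<lambda>n. form_norm \<mu> E (\<lambda>x. u n x - f x)) \<longlonglongrightarrow> 0)) \<and>
     \<comment> \<open>Markov property: the unit contraction operates\<close>
     (\<forall>f\<in>D. (\<lambda>x. min 1 (max 0 (f x))) \<in> D \<and>
            E (\<lambda>x. min 1 (max 0 (f x))) (\<lambda>x. min 1 (max 0 (f x))) \<le> E f f)"

definition cont_compact_support :: "('a::metric_space \<Rightarrow> real) set" where
  "cont_compact_support = {f. continuous_on UNIV f \<and> compact (closure {x. f x \<noteq> 0})}"

definition regular_form ::
  "'a::metric_space measure \<Rightarrow> ('a \<Rightarrow> real) set \<Rightarrow> (('a \<Rightarrow> real) \<Rightarrow> ('a \<Rightarrow> real) \<Rightarrow> real) \<Rightarrow> bool"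
  where
  "regular_form \<mu> D E \<longleftrightarrow>
     (\<forall>f\<in>D. \<forall>e>0. \<exists>g\<in>D \<inter> cont_compact_support. form_norm \<mu> E (\<lambda>x. f x - g x) < e) \<and>
     (\<forall>f\<in>cont_compact_support. \<forall>e>0. \<exists>g\<in>D \<inter> cont_compact_support. \<forall>x. \<bar>f x - g x\<bar> < e)"

text \<open>The support of the measure $|f|\,d\mu$.\<close>

definition ess_support :: "'a::metric_space measure \<Rightarrow> ('a \<Rightarrow> real) \<Rightarrow> 'a set" where
  "ess_support \<mu> f = {x. \<forall>U. open U \<and> x \<in> U \<longrightarrow> \<not> (AE y in \<mu>. y \<in> U \<longrightarrow> f y = 0)}"

definition strongly_local_form ::
  "'a::metric_space measure \<Rightarrow> ('a \<Rightarrow> real) set \<Rightarrow> (('a \<Rightarrow> real) \<Rightarrow> ('a \<Rightarrow> real) \<Rightarrow> real) \<Rightarrow> bool"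
  where
  "strongly_local_form \<mu> D E \<longleftrightarrow>
     (\<forall>f\<in>D. \<forall>g\<in>D.
        compact (ess_support \<mu> f) \<and> compact (ess_support \<mu> g) \<and>
        (\<exists>U c. open U \<and> ess_support \<mu> f \<subseteq> U \<and> (AE y in \<mu>. y \<in> U \<longrightarrow> g y = c)) \<longrightarrow>
        E f g = 0)"

definition carre_du_champ ::
  "'a measure \<Rightarrow> ('a \<Rightarrow> real) set \<Rightarrow> (('a \<Rightarrow> real) \<Rightarrow> ('a \<Rightarrow> real) \<Rightarrow> real)
     \<Rightarrow> (('a \<Rightarrow> real) \<Rightarrow> ('a \<Rightarrow> real) \<Rightarrow> ('a \<Rightarrow> real)) \<Rightarrow> bool" where
  "carre_du_champ \<mu> D E \<Gamma> \<longleftrightarrow>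
     (let B = D \<inter> Linf_space \<mu> in
       (\<forall>f\<in>B. \<forall>g\<in>B. \<Gamma> f g \<in> Lp_space \<mu> 1) \<and>
       (\<forall>f\<in>B. \<forall>f'\<in>B. \<forall>g\<in>B. \<forall>g'\<in>B.
          ae_eq \<mu> f f' \<and> ae_eq \<mu> g g' \<longrightarrow> ae_eq \<mu> (\<Gamma> f g) (\<Gamma> f' g')) \<and>
       (\<forall>f\<in>B. \<forall>g\<in>B. \<forall>h\<in>B. \<forall>a b.
          ae_eq \<mu> (\<Gamma> (\<lambda>x. a * f x + b * g x) h) (\<lambda>x. a * \<Gamma> f h x + b * \<Gamma> g h x) \<and>
          ae_eq \<mu> (\<Gamma> h (\<lambda>x. a * f x + b * g x)) (\<lambda>x. a * \<Gamma> h f x + b * \<Gamma> h g x)) \<and>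
       (\<forall>f\<in>B. AE x in \<mu>. 0 \<le> \<Gamma> f f x) \<and>
       (\<forall>f\<in>B. \<forall>g\<in>B. \<forall>h\<in>B.
          1 / 2 * (E (\<lambda>x. f x * h x) g + E f (\<lambda>x. g x * h x) - E (\<lambda>x. f x * g x) h)
            = (\<integral>x. h x * \<Gamma> f g x \<partial>\<mu>)))"

definition admits_carre_du_champ ::
  "'a measure \<Rightarrow> ('a \<Rightarrow> real) set \<Rightarrow> (('a \<Rightarrow> real) \<Rightarrow> ('a \<Rightarrow> real) \<Rightarrow> real) \<Rightarrow> bool" where
  "admits_carre_du_champ \<mu> D E \<longleftrightarrow> (\<exists>\<Gamma>. carre_du_champ \<mu> D E \<Gamma>)"

section \<open>The semigroup, its heat kernel and resolvent density\<close>

text \<open>Only the operators \<open>P t\<close> with \<open>t > 0\<close> are ever used.\<close>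

definition symmetric_markov_semigroup ::
  "'a measure \<Rightarrow> (real \<Rightarrow> ('a \<Rightarrow> real) \<Rightarrow> ('a \<Rightarrow> real)) \<Rightarrow> bool" where
  "symmetric_markov_semigroup \<mu> P \<longleftrightarrow>
     (\<forall>t>0. L2_operator \<mu> (Lp_space \<mu> 2) (P t)) \<and>
     (\<forall>t>0. \<forall>f\<in>Lp_space \<mu> 2. Lp_norm \<mu> 2 (P t f) \<le> Lp_norm \<mu> 2 f) \<and>
     (\<forall>t>0. \<forall>f\<in>Lp_space \<mu> 2. \<forall>g\<in>Lp_space \<mu> 2. L2_inner \<mu> (P t f) g = L2_inner \<mu> f (P t g)) \<and>
     (\<forall>s>0. \<forall>t>0. \<forall>f\<in>Lp_space \<mu> 2. ae_eq \<mu> (P (s + t) f) (P s (P t f))) \<and>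
     (\<forall>f\<in>Lp_space \<mu> 2. ((\<lambda>t. Lp_norm \<mu> 2 (\<lambda>x. P t f x - f x)) \<longlongrightarrow> 0) (at_right 0)) \<and>
     (\<forall>t>0. \<forall>f\<in>Lp_space \<mu> 2.
        (AE x in \<mu>. 0 \<le> f x \<and> f x \<le> 1) \<longrightarrow> (AE x in \<mu>. 0 \<le> P t f x \<and> P t f x \<le> 1))"

definition semigroup_generator ::
  "'a measure \<Rightarrow> (real \<Rightarrow> ('a \<Rightarrow> real) \<Rightarrow> ('a \<Rightarrow> real))
     \<Rightarrow> ('a \<Rightarrow> real) set \<Rightarrow> (('a \<Rightarrow> real) \<Rightarrow> ('a \<Rightarrow> real)) \<Rightarrow> bool" where
  "semigroup_generator \<mu> P D A \<longleftrightarrow>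
     (\<forall>f\<in>Lp_space \<mu> 2. \<forall>h\<in>Lp_space \<mu> 2.
        (f \<in> D \<and> ae_eq \<mu> (A f) h) \<longleftrightarrow>
        ((\<lambda>t. Lp_norm \<mu> 2 (\<lambda>x. (P t f x - f x) / t - h x)) \<longlongrightarrow> 0) (at_right 0))"

text \<open>
  A Markov operator \<open>S\<close> on $L^2$ extends to $L^\infty$ by monotone limits: if
  $0 \le u_n \uparrow f^+$ and $0 \le v_n \uparrow f^-$ with $u_n, v_n \in L^2$, then
  $Sf = \lim_n (S u_n - S v_n)$ almost everywhere.  The relation says that \<open>g\<close> is a version of
  this extension applied to \<open>f\<close>.
\<close>

definition Linf_extension ::
  "'a measure \<Rightarrow> (('a \<Rightarrow> real) \<Rightarrow> ('a \<Rightarrow> real)) \<Rightarrow> ('a \<Rightarrow> real) \<Rightarrow> ('a \<Rightarrow> real) \<Rightarrow> bool" where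
  "Linf_extension \<mu> S f g \<longleftrightarrow>
     (\<exists>u v. (\<forall>n. u n \<in> Lp_space \<mu> 2 \<and> v n \<in> Lp_space \<mu> 2) \<and>
        (\<forall>n x. 0 \<le> u n x \<and> u n x \<le> u (Suc n) x \<and> 0 \<le> v n x \<and> v n x \<le> v (Suc n) x) \<and>
        (\<forall>x. (\<lambda>n. u n x) \<longlonglongrightarrow> max (f x) 0 \<and> (\<lambda>n. v n x) \<longlonglongrightarrow> max (- f x) 0) \<and>
        (AE x in \<mu>. (\<lambda>n. S (u n) x - S (v n) x) \<longlonglongrightarrow> g x))"

definition strong_feller ::
  "'a::metric_space measure \<Rightarrow> (real \<Rightarrow> ('a \<Rightarrow> real) \<Rightarrow> ('a \<Rightarrow> real)) \<Rightarrow> bool" where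
  "strong_feller \<mu> P \<longleftrightarrow>
     (\<forall>t>0. \<forall>f\<in>Linf_space \<mu>. \<exists>g\<in>bcontfun. Linf_extension \<mu> (P t) f g)"

text \<open>The continuous version is unique if \<open>\<mu>\<close> has full support; it gives $P_tf(x)$ a meaning.\<close>

definition continuous_version ::
  "'a::metric_space measure \<Rightarrow> (('a \<Rightarrow> real) \<Rightarrow> ('a \<Rightarrow> real)) \<Rightarrow> ('a \<Rightarrow> real) \<Rightarrow> ('a \<Rightarrow> real)" where
  "continuous_version \<mu> S f = (THE g. g \<in> bcontfun \<and> Linf_extension \<mu> S f g)"

definition transition_prob ::
  "'a::metric_space measure \<Rightarrow> (real \<Rightarrow> ('a \<Rightarrow> real) \<Rightarrow> ('a \<Rightarrow> real))
     \<Rightarrow> real \<Rightarrow> 'a \<Rightarrow> 'a set \<Rightarrow> real" where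
  "transition_prob \<mu> P t x A = continuous_version \<mu> (P t) (indicator A) x"

definition is_transition_density ::
  "'a::metric_space measure \<Rightarrow> (real \<Rightarrow> ('a \<Rightarrow> real) \<Rightarrow> ('a \<Rightarrow> real))
     \<Rightarrow> real \<Rightarrow> 'a \<Rightarrow> ('a \<Rightarrow> ennreal) \<Rightarrow> bool" where
  "is_transition_density \<mu> P t x q \<longleftrightarrow>
     q \<in> borel_measurable \<mu> \<and>
     (\<forall>A\<in>sets \<mu>. ennreal (transition_prob \<mu> P t x A) = (\<integral>\<^sup>+y\<in>A. q y \<partial>\<mu>))"

definition absolutely_continuous_semigroup ::
  "'a::metric_space measure \<Rightarrow> (real \<Rightarrow> ('a \<Rightarrow> real) \<Rightarrow> ('a \<Rightarrow> real)) \<Rightarrow> bool" where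
  "absolutely_continuous_semigroup \<mu> P \<longleftrightarrow>
     strong_feller \<mu> P \<and> (\<forall>t>0. \<forall>x. \<exists>q. is_transition_density \<mu> P t x q)"

definition transition_density ::
  "'a::metric_space measure \<Rightarrow> (real \<Rightarrow> ('a \<Rightarrow> real) \<Rightarrow> ('a \<Rightarrow> real))
     \<Rightarrow> real \<Rightarrow> 'a \<Rightarrow> 'a \<Rightarrow> ennreal" where
  "transition_density \<mu> P t x = (SOME q. is_transition_density \<mu> P t x q)"

text \<open>Densities are unique almost everywhere, so the kernel does not depend on the choice.\<close>

definition heat_kernel ::
  "'a::metric_space measure \<Rightarrow> (real \<Rightarrow> ('a \<Rightarrow> real) \<Rightarrow> ('a \<Rightarrow> real))
     \<Rightarrow> real \<Rightarrow> 'a \<Rightarrow> 'a \<Rightarrow> ennreal" where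
  "heat_kernel \<mu> P t x y =
     (\<integral>\<^sup>+z. transition_density \<mu> P (t / 2) x z * transition_density \<mu> P (t / 2) y z \<partial>\<mu>)"

definition resolvent_density ::
  "'a::metric_space measure \<Rightarrow> (real \<Rightarrow> ('a \<Rightarrow> real) \<Rightarrow> ('a \<Rightarrow> real))
     \<Rightarrow> real \<Rightarrow> 'a \<Rightarrow> 'a \<Rightarrow> ennreal" where
  "resolvent_density \<mu> P lam x y =
     (\<integral>\<^sup>+t\<in>{0<..}. ennreal (exp (- lam * t)) * heat_kernel \<mu> P t x y \<partial>lborel)"

definition resolvent ::
  "'a::metric_space measure \<Rightarrow> (real \<Rightarrow> ('a \<Rightarrow> real) \<Rightarrow> ('a \<Rightarrow> real))
     \<Rightarrow> real \<Rightarrow> ('a \<Rightarrow> real) \<Rightarrow> 'a \<Rightarrow> ennreal" where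
  "resolvent \<mu> P lam f x = (\<integral>\<^sup>+y. resolvent_density \<mu> P lam x y * ennreal (f y) \<partial>\<mu>)"

text \<open>$r^{2-d}$ for $r \ge 0$, with $0^{2-d} = +\infty$ if $d > 2$ and $0^0 = 1$.\<close>

definition riesz_bound :: "real \<Rightarrow> real \<Rightarrow> ennreal" where
  "riesz_bound d r =
     (if r = 0 then (if d > 2 then \<infinity> else if d = 2 then 1 else 0) else ennreal (r powr (2 - d)))"

section \<open>Capacities and Hausdorff measures\<close>

text \<open>The infimum over the empty set is \<open>\<infinity>\<close>.\<close>

definition Cap2 ::
  "'a::metric_space measure \<Rightarrow> (real \<Rightarrow> ('a \<Rightarrow> real) \<Rightarrow> ('a \<Rightarrow> real))
     \<Rightarrow> real \<Rightarrow> real \<Rightarrow> 'a set \<Rightarrow> ennreal" where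
  "Cap2 \<mu> P lam p S =
     (INF f\<in>{f \<in> Lp_space \<mu> p. (AE x in \<mu>. 0 \<le> f x) \<and> (\<forall>x\<in>S. 1 \<le> resolvent \<mu> P lam f x)}.
        ennreal (Lp_norm \<mu> p f powr p))"

definition hausdorff_function :: "(real \<Rightarrow> real) \<Rightarrow> bool" where
  "hausdorff_function h \<longleftrightarrow>
     mono_on {0..} h \<and>
     (\<forall>r\<ge>0. continuous (at_right r) h) \<and>
     0 \<le> h 0 \<and> (\<forall>r>0. 0 < h r) \<and>
     (\<exists>c>1. \<forall>r>0. h (2 * r) \<le> c * h r)"

text \<open>
  Boundedness is required because \<open>diameter\<close> is unspecified for unbounded sets.  Covers are
  countable families, possibly finite or empty, so no padding with empty sets is needed.
\<close>

definition hausdorff_premeasure :: "(real \<Rightarrow> real) \<Rightarrow> real \<Rightarrow> 'a::metric_space set \<Rightarrow> ennreal" where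
  "hausdorff_premeasure h \<delta> S =
     (INF \<U>\<in>{\<U>. countable \<U> \<and> S \<subseteq> \<Union>\<U> \<and> (\<forall>U\<in>\<U>. bounded U \<and> diameter U < \<delta>)}.
        \<integral>\<^sup>+U. ennreal (h (diameter U)) \<partial>count_space \<U>)"

definition hausdorff_measure :: "(real \<Rightarrow> real) \<Rightarrow> 'a::metric_space set \<Rightarrow> ennreal" where
  "hausdorff_measure h S = Lim (at_right 0) (\<lambda>\<delta>. hausdorff_premeasure h \<delta> S)"

text \<open>The case distinction is needed since \<open>0 powr 0 = 0\<close>, whereas here $0^0 = 1$.\<close>

definition hausdorff_measure_dim :: "real \<Rightarrow> 'a::metric_space set \<Rightarrow> ennreal" where
  "hausdorff_measure_dim s = hausdorff_measure (\<lambda>r. if s = 0 then 1 else r powr s)"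

text \<open>
  $\int_0^1 (-\log r)\,dh(r)$, where $dh$ is the Lebesgue--Stieltjes measure on $[0,+\infty)$ with
  $dh([0,r]) = h(r)$, and $-\log 0 = +\infty$.  The mass $h(0)$ at the origin is counted, so that
  a finite integral forces $h(0) = 0$.
\<close>

definition log_stieltjes_integral :: "(real \<Rightarrow> real) \<Rightarrow> ennreal" where
  "log_stieltjes_integral h =
     (\<integral>\<^sup>+r\<in>{0..1}. (if r = 0 then \<infinity> else ennreal (- ln r))
        \<partial>interval_measure (\<lambda>r. if r < 0 then 0 else h r))"

end

theory Submission
  imports Defs
begin

text \<open>
  The resolvent kernel is bounded by the Riesz kernel \<open>\<rho>\<^bsup>2-d\<^esup>\<close>, and balls have measure at most
  \<open>C r\<^sup>d\<close>.  Vanishing capacity therefore supplies, for every compact subset \<open>K\<close> of \<open>\<Sigma>\<close>,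
  nonnegative functions \<open>f\<close> of arbitrarily small \<open>L\<^sup>p\<close>-norm whose Riesz potential is bounded
  below on \<open>K\<close> by a fixed constant (\<open>Cap2_eq_0_imp_small_potential\<close>).  It has to be shown that \<open>K\<close>
  can then be covered by balls with small \<open>\<Sum> h(r)\<close>.  As the space is \<open>\<sigma>\<close>-compact and \<open>\<Sigma>\<close> is
  closed, this suffices (\<open>hausdorff_measure_null_if_compact_subsets_null\<close>).

  For \<open>h(r) = r\<^sup>s\<close> with \<open>s > d - 2p > 0\<close> there is room to argue pointwise.  If the \<open>f\<^sup>p\<close>-mass of
  all small balls about \<open>x\<close> were at most \<open>\<tau> r\<^sup>s\<close>, summing over dyadic annuli would make the
  potential at \<open>x\<close> too small; hence each point of \<open>K\<close> is the centre of a ball with mass more than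
  \<open>\<tau> r\<^sup>s\<close> (\<open>large_potential_imp_concentration\<close>), and a Vitali cover by such balls has
  \<open>\<Sum> r\<^sup>s\<close> bounded by the total mass divided by \<open>\<tau>\<close>.  The case \<open>p = 2\<close> contains the first
  assertion.

  For \<open>d = 4\<close>, \<open>p = 2\<close> the same argument would need \<open>\<Sum> h(2\<^bsup>-j\<^esup>)\<^bsup>1/2\<^esup> < \<infinity>\<close>, whereas the
  hypothesis on \<open>h\<close> only gives \<open>\<Sum> h(2\<^bsup>-j\<^esup>) < \<infinity>\<close>
  (\<open>hausdorff_function_dyadic_summable\<close>).  Duality bridges the gap.  A finite measure \<open>\<nu>\<close> with
  \<open>\<nu>(B(x,r)) \<le> h(r)\<close> has logarithmic energy at most a constant times its mass
  (\<open>dyadic_energy_le\<close>), and testing the lower bound of the potential against \<open>\<nu>\<close> shows that the mass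
  of \<open>\<nu>\<close> is at most a constant times \<open>\<parallel>f\<parallel>\<^sup>2\<close> (\<open>frostman_mass_le\<close>).  Conversely, choosing
  \<open>\<nu>\<close> maximal on a fine net of \<open>K\<close> (\<open>saturating_weights\<close>) puts every point of the net into
  a ball with \<open>\<nu>(B) = h(r)\<close>, and a Vitali cover by such balls bounds the Hausdorff content of \<open>K\<close> by
  the mass of \<open>\<nu>\<close>.  Working on a net and with a truncated dyadic kernel keeps everything finite.
\<close>

section \<open>Selecting balls and points\<close>

text \<open>
  The greedy choice: a ball of largest radius swallows, after tripling, every ball that meets it,
  and the balls that miss it are treated by induction.
\<close>
lemma finite_Vitali_covering:
  fixes a :: "'i \<Rightarrow> 'a::metric_space"
  assumes "finite I"
  shows "\<exists>J\<subseteq>I. disjoint_family_on (\<lambda>i. ball (a i) (r i)) J \<and>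
           (\<Union>i\<in>I. ball (a i) (r i)) \<subseteq> (\<Union>i\<in>J. ball (a i) (3 * r i))"
  using assms
proof (induction I rule: finite_psubset_induct)
  case (psubset I)
  show ?case
  proof (cases "I = {}")
    case True
    then show ?thesis by (auto simp: disjoint_family_on_def)
  next
    case False
    have "Max (r ` I) \<in> r ` I" using False psubset.hyps by simp
    then obtain i0 where i0: "i0 \<in> I" "r i0 = Max (r ` I)" by auto
    have max: "r i \<le> r i0" if "i \<in> I" for i
      using that i0 psubset.hyps by simp
    define I' where "I' = {i \<in> I. i \<noteq> i0 \<and> ball (a i) (r i) \<inter> ball (a i0) (r i0) = {}}"
    have "I' \<subset> I" using i0 by (auto simp: I'_def)
    from psubset.IH[OF this] obtain J where J: "J \<subseteq> I'"
      "disjoint_family_on (\<lambda>i. ball (a i) (r i)) J"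
      "(\<Union>i\<in>I'. ball (a i) (r i)) \<subseteq> (\<Union>i\<in>J. ball (a i) (3 * r i))" by blast
    have "disjoint_family_on (\<lambda>i. ball (a i) (r i)) (insert i0 J)"
      using J(1,2) by (fastforce simp: disjoint_family_on_def I'_def)
    moreover have "ball (a i) (r i) \<subseteq> (\<Union>i\<in>insert i0 J. ball (a i) (3 * r i))" if "i \<in> I" for i
    proof (cases "i \<in> I'")
      case True
      then show ?thesis using J(3) by blast
    next
      case False
      show ?thesis
      proof
        fix x assume x: "x \<in> ball (a i) (r i)"
        have "x \<in> ball (a i0) (3 * r i0)"
        proof (cases "i = i0")
          case True
          have "0 \<le> dist (a i0) x" by simp
          with x True show ?thesis by (auto simp del: zero_le_dist)
        next
          case neq: False
          with False that obtain z where z: "z \<in> ball (a i) (r i)" "z \<in> ball (a i0) (r i0)"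
            by (auto simp: I'_def)
          have "dist (a i0) x \<le> dist (a i0) z + dist z (a i) + dist (a i) x"
            using dist_triangle[of "a i0" x z] dist_triangle[of z x "a i"] by linarith
          with z x max[OF that] show ?thesis by (auto simp: dist_commute)
        qed
        then show "x \<in> (\<Union>i\<in>insert i0 J. ball (a i) (3 * r i))" by blast
      qed
    qed
    moreover have "insert i0 J \<subseteq> I" using J(1) i0 by (auto simp: I'_def)
    ultimately show ?thesis by blast
  qed
qed

lemma compact_finite_ball_subcover:
  fixes K :: "'a::metric_space set"
  assumes "compact K" and "\<And>x. x \<in> K \<Longrightarrow> 0 < r x"
  shows "\<exists>I\<subseteq>K. finite I \<and> K \<subseteq> (\<Union>x\<in>I. ball x (r x))"
proof -
  have "K \<subseteq> (\<Union>x\<in>K. ball x (r x))" using assms(2) by force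
  then obtain I where "I \<subseteq> K" "finite I" "K \<subseteq> (\<Union>x\<in>I. ball x (r x))"
    by (rule compactE_image[OF assms(1) open_ball])
  then show ?thesis by (intro exI[of _ I] conjI)
qed

text \<open>
  A combinatorial substitute for Frostman's lemma.  The weights are raised one point at a time, each
  until some capacity constraint through the point becomes tight; tight constraints stay tight
  because weights are never lowered.  In the application the sets \<open>U b\<close> are balls and \<open>cap b\<close> is the
  value of a Hausdorff function at the radius, so that the weights form a discrete measure with the
  growth of a Frostman measure, and the tight balls yield an economical cover.
\<close>
lemma saturating_weights:
  fixes cap :: "'b \<Rightarrow> real" and U :: "'b \<Rightarrow> 'a set"
  assumes "finite X" and "finite \<B>" and "\<And>b. b \<in> \<B> \<Longrightarrow> 0 \<le> cap b" and "X \<subseteq> (\<Union>b\<in>\<B>. U b)"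
  shows "\<exists>w. (\<forall>x. 0 \<le> w x) \<and>
           (\<forall>b\<in>\<B>. (\<Sum>x\<in>X \<inter> U b. w x) \<le> cap b) \<and>
           (\<forall>x\<in>X. \<exists>b\<in>\<B>. x \<in> U b \<and> (\<Sum>x\<in>X \<inter> U b. w x) = cap b)"
  using assms(1,4)
proof (induction X)
  case empty
  show ?case by (rule exI[of _ "\<lambda>_. 0"]) (auto simp: assms)
next
  case (insert x X)
  then obtain w :: "'a \<Rightarrow> real" where w: "\<And>x. 0 \<le> w x" "\<And>b. b \<in> \<B> \<Longrightarrow> (\<Sum>x\<in>X \<inter> U b. w x) \<le> cap b"
    "\<And>x. x \<in> X \<Longrightarrow> \<exists>b\<in>\<B>. x \<in> U b \<and> (\<Sum>x\<in>X \<inter> U b. w x) = cap b" by blast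
  define slack where "slack b = cap b - (\<Sum>x\<in>X \<inter> U b. w x)" for b
  define C where "C = {b \<in> \<B>. x \<in> U b}"
  define m where "m = Min (slack ` C)"
  have C: "finite C" "C \<noteq> {}" using assms(2) insert.prems by (auto simp: C_def)
  have "m \<in> slack ` C" using C by (simp add: m_def)
  then obtain b0 where b0: "b0 \<in> C" "m = slack b0" by auto
  have m_le: "m \<le> slack b" if "b \<in> C" for b using that C by (simp add: m_def)
  have m0: "0 \<le> m" using b0 w(2) by (auto simp: slack_def C_def)
  define w' where "w' = w(x := m)"
  have eq: "(\<Sum>y\<in>insert x X \<inter> U b. w' y) = (if x \<in> U b then m else 0) + (\<Sum>y\<in>X \<inter> U b. w y)" for b
  proof -
    have "(\<Sum>y\<in>X \<inter> U b. w' y) = (\<Sum>y\<in>X \<inter> U b. w y)"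
      using insert.hyps by (intro sum.cong) (auto simp: w'_def)
    then show ?thesis using insert.hyps by (auto simp: Int_insert_left w'_def)
  qed
  have tight: "(\<Sum>y\<in>insert x X \<inter> U b. w' y) = cap b"
    if "b \<in> \<B>" "(\<Sum>x\<in>X \<inter> U b. w x) = cap b" for b
    using that m_le[of b] m0 by (auto simp: eq slack_def C_def)
  show ?case
  proof (rule exI[of _ w'], intro conjI ballI allI)
    fix y show "0 \<le> w' y" using w(1) m0 by (simp add: w'_def)
  next
    fix b assume "b \<in> \<B>"
    then show "(\<Sum>y\<in>insert x X \<inter> U b. w' y) \<le> cap b"
      using m_le[of b] w(2)[of b] by (auto simp: eq slack_def C_def)
  next
    fix y assume "y \<in> insert x X"
    then show "\<exists>b\<in>\<B>. y \<in> U b \<and> (\<Sum>y\<in>insert x X \<inter> U b. w' y) = cap b"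
    proof
      assume "y = x"
      then show ?thesis using b0 by (auto intro!: bexI[of _ b0] simp: eq slack_def C_def)
    next
      assume "y \<in> X"
      with w(3)[of y] tight show ?thesis by blast
    qed
  qed
qed

section \<open>Null sets of Hausdorff measures\<close>

lemma hausdorff_premeasure_ball_cover:
  fixes a :: "'i \<Rightarrow> 'a::metric_space"
  assumes "finite I" and "S \<subseteq> (\<Union>i\<in>I. ball (a i) (r i))"
    and "\<And>i. i \<in> I \<Longrightarrow> 0 \<le> r i" and "\<And>i. i \<in> I \<Longrightarrow> 2 * r i < \<delta>" and "mono_on {0..} h"
  shows "hausdorff_premeasure h \<delta> S \<le> (\<Sum>i\<in>I. ennreal (h (2 * r i)))"
proof -
  define \<U> where "\<U> = (\<lambda>i. ball (a i) (r i)) ` I"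
  have diam: "diameter (ball (a i) (r i)) \<le> 2 * r i" if "i \<in> I" for i
  proof (cases "ball (a i) (r i) = {}")
    case True
    then show ?thesis using assms(3)[OF that] by simp
  next
    case False
    then have "diameter (ball (a i) (r i)) =
        (SUP (x, y)\<in>ball (a i) (r i) \<times> ball (a i) (r i). dist x y)"
      by (simp add: diameter_def)
    also have "\<dots> \<le> 2 * r i"
    proof (rule cSUP_least)
      fix p assume p: "p \<in> ball (a i) (r i) \<times> ball (a i) (r i)"
      obtain x y where xy: "p = (x, y)" by fastforce
      have "dist x y \<le> dist (a i) x + dist (a i) y" by (rule dist_triangle3)
      with p show "(case p of (x, y) \<Rightarrow> dist x y) \<le> 2 * r i" by (auto simp: xy)
    qed (use False in auto)
    finally show ?thesis .
  qed
  have "hausdorff_premeasure h \<delta> S \<le> (\<integral>\<^sup>+U. ennreal (h (diameter U)) \<partial>count_space \<U>)"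
    unfolding hausdorff_premeasure_def
  proof (rule INF_lower, safe)
    show "countable \<U>" using assms(1) by (simp add: \<U>_def countable_finite)
    show "x \<in> \<Union>\<U>" if "x \<in> S" for x using that assms(2) unfolding \<U>_def by blast
    show "bounded U" if "U \<in> \<U>" for U using that by (auto simp: \<U>_def)
    show "diameter U < \<delta>" if "U \<in> \<U>" for U
      using that diam assms(4) by (force simp: \<U>_def)
  qed
  also have "\<dots> = (\<Sum>U\<in>\<U>. ennreal (h (diameter U)))"
    using assms(1) by (simp add: \<U>_def nn_integral_count_space_finite)
  also have "\<dots> \<le> (\<Sum>i\<in>I. ennreal (h (diameter (ball (a i) (r i)))))"
    unfolding \<U>_def using sum_image_le[OF assms(1), of "\<lambda>U. ennreal (h (diameter U))"] by simp
  also have "\<dots> \<le> (\<Sum>i\<in>I. ennreal (h (2 * r i)))"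
  proof (intro sum_mono ennreal_leI)
    fix i assume i: "i \<in> I"
    show "h (diameter (ball (a i) (r i))) \<le> h (2 * r i)"
      using diam[OF i] assms(3)[OF i]
      by (intro mono_onD[OF assms(5)]) (auto simp: diameter_ge_0)
  qed
  finally show ?thesis .
qed

lemma hausdorff_premeasure_UN_null:
  fixes S :: "nat \<Rightarrow> 'a::metric_space set"
  assumes "\<And>n. hausdorff_premeasure h \<delta> (S n) = 0"
  shows "hausdorff_premeasure h \<delta> (\<Union>n. S n) = 0"
proof -
  let ?g = "\<lambda>U::'a set. ennreal (h (diameter U))"
  have "hausdorff_premeasure h \<delta> (\<Union>n. S n) \<le> 0 + ennreal e" if "e > 0" for e
  proof -
    have "\<exists>\<U>. countable \<U> \<and> S n \<subseteq> \<Union>\<U> \<and> (\<forall>U\<in>\<U>. bounded U \<and> diameter U < \<delta>) \<and>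
        (\<integral>\<^sup>+U. ?g U \<partial>count_space \<U>) < ennreal (e * (1/2) ^ Suc n)" for n
    proof -
      have "hausdorff_premeasure h \<delta> (S n) < ennreal (e * (1/2) ^ Suc n)"
      using \<open>e > 0\<close> unfolding assms[of n] by simp
      then show ?thesis
        unfolding hausdorff_premeasure_def INF_less_iff by blast
    qed
    then obtain \<U> where \<U>: "\<And>n. countable (\<U> n)" "\<And>n. S n \<subseteq> \<Union>(\<U> n)"
      "\<And>n U. U \<in> \<U> n \<Longrightarrow> bounded U \<and> diameter U < \<delta>"
      "\<And>n. (\<integral>\<^sup>+U. ?g U \<partial>count_space (\<U> n)) < ennreal (e * (1/2) ^ Suc n)" by metis
    have "hausdorff_premeasure h \<delta> (\<Union>n. S n) \<le> (\<integral>\<^sup>+U. ?g U \<partial>count_space (\<Union>n. \<U> n))"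
      unfolding hausdorff_premeasure_def
    proof (rule INF_lower, intro CollectI conjI ballI)
      show "countable (\<Union>n. \<U> n)" using \<U>(1) by simp
      show "(\<Union>n. S n) \<subseteq> \<Union>(\<Union>n. \<U> n)" using \<U>(2) by blast
    qed (use \<U>(3) in blast)+
    also have "\<dots> = (\<integral>\<^sup>+U. ?g U * indicator (\<Union>n. \<U> n) U \<partial>count_space UNIV)"
      by (simp add: nn_integral_count_space_indicator)
    also have "\<dots> \<le> (\<integral>\<^sup>+U. (\<Sum>n. ?g U * indicator (\<U> n) U) \<partial>count_space UNIV)"
    proof (rule nn_integral_mono)
      fix U
      show "?g U * indicator (\<Union>n. \<U> n) U \<le> (\<Sum>n. ?g U * indicator (\<U> n) U)"
      proof (cases "U \<in> (\<Union>n. \<U> n)")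
        case True
        then obtain n where "U \<in> \<U> n" by blast
        then have "?g U * indicator (\<Union>n. \<U> n) U = (\<Sum>k\<in>{n}. ?g U * indicator (\<U> k) U)"
          using True by simp
        also have "\<dots> \<le> (\<Sum>n. ?g U * indicator (\<U> n) U)"
          by (rule sum_le_suminf) auto
        finally show ?thesis .
      qed auto
    qed
    also have "\<dots> = (\<Sum>n. \<integral>\<^sup>+U. ?g U * indicator (\<U> n) U \<partial>count_space UNIV)"
      by (rule nn_integral_suminf) auto
    also have "\<dots> = (\<Sum>n. \<integral>\<^sup>+U. ?g U \<partial>count_space (\<U> n))"
      by (simp add: nn_integral_count_space_indicator)
    also have "\<dots> \<le> (\<Sum>n. ennreal (e * (1/2) ^ Suc n))"
      by (intro suminf_le less_imp_le[OF \<U>(4)]) auto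
    also have "\<dots> = ennreal e"
    proof (rule suminf_ennreal_eq)
      show "(\<lambda>n. e * (1/2) ^ Suc n) sums e"
        using sums_mult[OF power_half_series, of e] unfolding mult_1_right .
      show "0 \<le> e * (1/2) ^ Suc n" for n
        using \<open>e > 0\<close> by (intro mult_nonneg_nonneg zero_le_power) auto
    qed
    finally show ?thesis by simp
  qed
  then have "hausdorff_premeasure h \<delta> (\<Union>n. S n) \<le> 0"
    by (rule ennreal_le_epsilon)
  then show ?thesis by simp
qed

lemma locally_compact_imp_sigma_compact:
  assumes "locally compact (UNIV :: 'a::{metric_space, second_countable_topology} set)"
  obtains K :: "nat \<Rightarrow> 'a::{metric_space, second_countable_topology} set" where "\<And>n. compact (K n)" and "(\<Union>n. K n) = UNIV"
proof -
  have "\<exists>U V. open U \<and> compact V \<and> x \<in> U \<and> U \<subseteq> V" for x :: 'a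
    using assms unfolding locally_def by simp (metis UNIV_I open_UNIV)
  then obtain U V :: "'a \<Rightarrow> 'a set" where UV: "\<And>x. open (U x)" "\<And>x. compact (V x)"
    "\<And>x. x \<in> U x" "\<And>x. U x \<subseteq> V x" by metis
  have "open W" if "W \<in> range U" for W using that UV(1) by blast
  from Lindelof[OF this] obtain \<F> where \<F>: "\<F> \<subseteq> range U" "countable \<F>" "\<Union>\<F> = \<Union>(range U)" .
  then obtain C where C: "countable C" "\<F> = U ` C"
    by (metis countable_subset_image)
  have cov: "(\<Union>x\<in>C. V x) = UNIV" using \<F>(3) C UV(3,4) by blast
  then have "C \<noteq> {}" by auto
  then have "range (from_nat_into C) = C" using C(1) by (simp add: range_from_nat_into)
  then have "(\<Union>n. V (from_nat_into C n)) = UNIV" using cov by (metis UN_simps(10))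
  with UV(2) show thesis by (intro that[of "\<lambda>n. V (from_nat_into C n)"]) auto
qed

text \<open>
  Null sets are stable under countable unions and the space is \<open>\<sigma>\<close>-compact, so a closed set is
  null as soon as its compact subsets are.  Compactness is what provides finite covers, and in the
  critical case a truncation of the kernel that works uniformly over the set.
\<close>
lemma hausdorff_measure_null_if_compact_subsets_null:
  fixes S :: "'a::{metric_space, second_countable_topology} set"
  assumes "locally compact (UNIV :: 'a set)" and "closed S"
    and "\<And>K \<delta>. compact K \<Longrightarrow> K \<subseteq> S \<Longrightarrow> \<delta> > 0 \<Longrightarrow> hausdorff_premeasure h \<delta> K = 0"
  shows "hausdorff_measure h S = 0"
proof -
  obtain K :: "nat \<Rightarrow> 'a set" where K: "\<And>n. compact (K n)" "(\<Union>n. K n) = UNIV"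
    using locally_compact_imp_sigma_compact[OF assms(1)] by blast
  have "hausdorff_premeasure h \<delta> S = 0" if "\<delta> > 0" for \<delta>
  proof -
    have "hausdorff_premeasure h \<delta> (\<Union>n. K n \<inter> S) = 0"
      by (intro hausdorff_premeasure_UN_null assms(3) compact_Int_closed K(1) assms(2) that) auto
    moreover have "(\<Union>n. K n \<inter> S) = S" using K(2) by blast
    ultimately show ?thesis by simp
  qed
  then have "((\<lambda>\<delta>. hausdorff_premeasure h \<delta> S) \<longlongrightarrow> 0) (at_right 0)"
    by (intro tendsto_eventually eventually_at_right_less[THEN eventually_mono]) auto
  then show ?thesis
    unfolding hausdorff_measure_def by (intro tendsto_Lim) auto
qed

section \<open>Riesz potentials and the subcritical case\<close>

text \<open>
  A pointwise replacement for Hoelder's inequality; the parameter \<open>t\<close> is optimised afterwards.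
\<close>
lemma le_add_powr:
  fixes a t p :: real
  assumes "0 \<le> a" "0 < t" "1 \<le> p"
  shows "a \<le> t + t powr (1 - p) * a powr p"
proof (cases "a \<le> t")
  case True
  then show ?thesis using assms by (simp add: add_increasing2)
next
  case False
  then have "a powr (1 - p) \<le> t powr (1 - p)"
    using assms by (intro powr_mono2') auto
  then have "a powr (1 - p) * a powr p \<le> t powr (1 - p) * a powr p"
    by (intro mult_right_mono) auto
  moreover have "a powr (1 - p) * a powr p = a"
    using False assms by (simp add: powr_add[symmetric])
  ultimately show ?thesis using assms by linarith
qed

lemma dyadic_decreasing:
  fixes D R :: real
  assumes "0 < D" "D < R"
  shows "\<exists>j. R * (1/2) ^ j / 2 \<le> D \<and> D < R * (1/2) ^ j"
proof -
  define P where "P j \<longleftrightarrow> R * (1/2) ^ j / 2 \<le> D" for j :: nat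
  obtain n where n: "(1/2::real) ^ n < D / R"
    using real_arch_pow_inv[of "D / R" "1/2"] assms by auto
  have "P n" using n assms by (simp add: P_def field_simps)
  define j where "j = (LEAST j. P j)"
  have "P j" unfolding j_def using \<open>P n\<close> by (rule LeastI)
  moreover have "D < R * (1/2) ^ j"
  proof (cases j)
    case 0
    then show ?thesis using assms by simp
  next
    case (Suc i)
    then have "\<not> P i" unfolding j_def by (metis not_less_Least lessI)
    then show ?thesis by (simp add: P_def Suc)
  qed
  ultimately show ?thesis unfolding P_def by blast
qed

lemma dyadic_increasing:
  fixes D R :: real
  assumes "0 < R" "R \<le> D"
  shows "\<exists>j. (2 * R) * 2 ^ j / 2 \<le> D \<and> D < (2 * R) * 2 ^ j"
proof -
  define P where "P j \<longleftrightarrow> D < (2 * R) * 2 ^ j" for j :: nat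
  obtain n where n: "D / R < 2 ^ n"
    using real_arch_pow[of 2 "D / R"] by auto
  have "D < R * 2 ^ n" using n assms by (simp add: field_simps)
  also have "\<dots> \<le> (2 * R) * 2 ^ n" using assms by simp
  finally have "P n" by (simp add: P_def)
  define j where "j = (LEAST j. P j)"
  have "P j" unfolding j_def using \<open>P n\<close> by (rule LeastI)
  moreover have "(2 * R) * 2 ^ j / 2 \<le> D"
  proof (cases j)
    case 0
    then show ?thesis using assms by simp
  next
    case (Suc i)
    then have "\<not> P i" unfolding j_def by (metis not_less_Least lessI)
    then show ?thesis by (simp add: P_def Suc)
  qed
  ultimately show ?thesis unfolding P_def by blast
qed

lemma measurable_riesz_bound [measurable]: "riesz_bound d \<in> borel_measurable borel"
  unfolding riesz_bound_def by measurable

locale upper_regular_measure =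
  fixes \<mu> :: "'a::{metric_space, second_countable_topology} measure" and d C :: real
  assumes sets_eq [measurable_cong]: "sets \<mu> = sets borel"
    and d_pos: "0 < d" and C_pos: "0 < C"
    and ball_growth: "\<And>x r. 0 < r \<Longrightarrow> emeasure \<mu> (ball x r) \<le> ennreal (C * r powr d)"
begin

lemma space_eq: "space \<mu> = UNIV"
  using sets_eq_imp_space_eq[OF sets_eq] by simp

lemma ball_in_sets [measurable]: "ball x r \<in> sets \<mu>"
  by (simp add: sets_eq)

lemma emeasure_singleton: "emeasure \<mu> {x} = 0"
proof -
  have "emeasure \<mu> {x} \<le> 0 + ennreal e" if "0 < e" for e
  proof -
    define r where "r = (e / C) powr (1 / d)"
    have r: "0 < r" "C * r powr d = e"
      using that C_pos d_pos by (simp_all add: r_def powr_powr)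
    have "emeasure \<mu> {x} \<le> emeasure \<mu> (ball x r)"
      using r by (intro emeasure_mono) auto
    also have "\<dots> \<le> ennreal e" using ball_growth[OF r(1), of x] r(2) by simp
    finally show ?thesis by simp
  qed
  then have "emeasure \<mu> {x} \<le> 0" by (rule ennreal_le_epsilon)
  then show ?thesis by simp
qed

lemma AE_neq: "AE y in \<mu>. y \<noteq> x"
  by (rule AE_I[of _ _ "{x}"]) (auto simp: emeasure_singleton sets_eq)

text \<open>
  The bound that Hoelder's inequality gives, with the level \<open>t = \<tau> r\<^bsup>(a-d)/p\<^esup>\<close> balancing
  the two terms of the pointwise estimate.
\<close>
lemma integral_ball_le:
  fixes f :: "'a \<Rightarrow> real"
  assumes [measurable]: "f \<in> borel_measurable \<mu>" and f: "\<And>y. 0 \<le> f y"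
    and "0 < \<tau>" "0 < r" "1 \<le> p"
    and bound: "(\<integral>\<^sup>+y\<in>ball x r. ennreal (f y powr p) \<partial>\<mu>) \<le> ennreal (\<tau> powr p * r powr a)"
  shows "(\<integral>\<^sup>+y\<in>ball x r. ennreal (f y) \<partial>\<mu>) \<le> ennreal ((C + 1) * \<tau> * r powr (d + (a - d) / p))"
proof -
  define t where "t = \<tau> * r powr ((a - d) / p)"
  have t: "0 < t" using assms by (simp add: t_def)
  have "(\<integral>\<^sup>+y\<in>ball x r. ennreal (f y) \<partial>\<mu>) \<le>
     (\<integral>\<^sup>+y. ennreal t * indicator (ball x r) y
        + ennreal (t powr (1 - p)) * (ennreal (f y powr p) * indicator (ball x r) y) \<partial>\<mu>)"
  proof (rule nn_integral_mono)
    fix y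
    have "ennreal (f y) \<le> ennreal t + ennreal (t powr (1 - p)) * ennreal (f y powr p)"
      using le_add_powr[of "f y" t p] t f[of y] \<open>1 \<le> p\<close>
      by (simp flip: ennreal_plus ennreal_mult')
    then show "ennreal (f y) * indicator (ball x r) y \<le> ennreal t * indicator (ball x r) y
        + ennreal (t powr (1 - p)) * (ennreal (f y powr p) * indicator (ball x r) y)"
      by (auto split: split_indicator)
  qed
  also have "\<dots> = ennreal t * emeasure \<mu> (ball x r)
      + ennreal (t powr (1 - p)) * (\<integral>\<^sup>+y\<in>ball x r. ennreal (f y powr p) \<partial>\<mu>)"
    by (subst nn_integral_add) (auto simp: nn_integral_cmult nn_integral_cmult_indicator)
  also have "\<dots> \<le> ennreal t * ennreal (C * r powr d)
      + ennreal (t powr (1 - p)) * ennreal (\<tau> powr p * r powr a)"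
    by (intro add_mono mult_left_mono ball_growth bound assms) auto
  also have "\<dots> = ennreal (t * (C * r powr d) + t powr (1 - p) * (\<tau> powr p * r powr a))"
    using t C_pos by (simp flip: ennreal_plus ennreal_mult')
  also have "t * (C * r powr d) = C * \<tau> * r powr (d + (a - d) / p)"
    by (simp add: t_def powr_add)
  also have "t powr (1 - p) * (\<tau> powr p * r powr a)
      = (\<tau> powr (1 - p) * \<tau> powr p) * (r powr ((a - d) / p * (1 - p)) * r powr a)"
    using assms by (simp add: t_def powr_mult powr_powr)
  also have "\<dots> = \<tau> * r powr (d + (a - d) / p)"
  proof -
    have "(a - d) / p * (1 - p) + a = d + (a - d) / p"
      using \<open>1 \<le> p\<close> by (simp add: field_simps)
    then show ?thesis using assms by (simp flip: powr_add)
  qed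
  finally show ?thesis by (simp add: algebra_simps)
qed

lemma riesz_annulus_le:
  fixes f :: "'a \<Rightarrow> real"
  assumes [measurable]: "f \<in> borel_measurable \<mu>" and f: "\<And>y. 0 \<le> f y"
    and "0 < \<tau>" "0 < r" "1 \<le> p" "2 \<le> d"
    and bound: "(\<integral>\<^sup>+y\<in>ball x r. ennreal (f y powr p) \<partial>\<mu>) \<le> ennreal (\<tau> powr p * r powr a)"
  shows "(\<integral>\<^sup>+y\<in>{y. r / 2 \<le> dist x y \<and> dist x y < r}. riesz_bound d (dist x y) * ennreal (f y) \<partial>\<mu>)
     \<le> ennreal (2 powr (d - 2) * (C + 1) * \<tau> * r powr (2 + (a - d) / p))"
    (is "?L \<le> _")
proof -
  have "?L \<le> (\<integral>\<^sup>+y. ennreal ((r / 2) powr (2 - d)) * (ennreal (f y) * indicator (ball x r) y) \<partial>\<mu>)"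
  proof (rule nn_integral_mono)
    fix y
    show "riesz_bound d (dist x y) * ennreal (f y)
          * indicator {y. r / 2 \<le> dist x y \<and> dist x y < r} y
        \<le> ennreal ((r / 2) powr (2 - d)) * (ennreal (f y) * indicator (ball x r) y)"
    proof (cases "r / 2 \<le> dist x y \<and> dist x y < r")
      case True
      then have "dist x y powr (2 - d) \<le> (r / 2) powr (2 - d)"
        using assms by (intro powr_mono2') auto
      then have "riesz_bound d (dist x y) \<le> ennreal ((r / 2) powr (2 - d))"
        using True \<open>0 < r\<close> by (auto simp: riesz_bound_def intro: ennreal_leI)
      with True show ?thesis by (auto intro!: mult_right_mono)
    qed auto
  qed
  also have "\<dots> = ennreal ((r / 2) powr (2 - d)) * (\<integral>\<^sup>+y\<in>ball x r. ennreal (f y) \<partial>\<mu>)"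
    by (rule nn_integral_cmult) measurable
  also have "\<dots> \<le> ennreal ((r / 2) powr (2 - d)) * ennreal ((C + 1) * \<tau> * r powr (d + (a - d) / p))"
    by (intro mult_left_mono integral_ball_le) (use assms in auto)
  also have "\<dots> = ennreal ((r / 2) powr (2 - d) * ((C + 1) * \<tau> * r powr (d + (a - d) / p)))"
    by (simp flip: ennreal_mult')
  also have "(r / 2) powr (2 - d) * ((C + 1) * \<tau> * r powr (d + (a - d) / p))
      = 2 powr (d - 2) * (C + 1) * \<tau> * r powr (2 + (a - d) / p)"
  proof -
    have half: "(r / 2) powr (2 - d) = r powr (2 - d) * 2 powr (d - 2)"
      using \<open>0 < r\<close> powr_minus_divide[of 2 "d - 2"] by (simp add: powr_divide)
    have comb: "r powr (2 - d) * r powr (d + (a - d) / p) = r powr (2 + (a - d) / p)"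
      using powr_add[of r "2 - d" "d + (a - d) / p"] by (simp add: algebra_simps)
    show ?thesis unfolding half comb[symmetric] by (simp only: mult_ac)
  qed
  finally show ?thesis .
qed

text \<open>
  The annuli of outer radii \<open>r q\<^sup>j\<close> contribute a geometric series.  With \<open>q = 1/2\<close> this
  controls the potential near \<open>x\<close> (for \<open>a > d - 2p\<close>), with \<open>q = 2\<close> and \<open>a = 0\<close>
  the potential far from \<open>x\<close>.
\<close>
lemma riesz_potential_dyadic_le:
  fixes f :: "'a \<Rightarrow> real"
  assumes [measurable]: "f \<in> borel_measurable \<mu>" and f: "\<And>y. 0 \<le> f y"
    and "0 < \<tau>" "0 < r" "0 < q" "1 \<le> p" "2 \<le> d"
    and q: "q powr (2 + (a - d) / p) < 1"
    and bound: "\<And>j. (\<integral>\<^sup>+y\<in>ball x (r * q ^ j). ennreal (f y powr p) \<partial>\<mu>)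
                  \<le> ennreal (\<tau> powr p * (r * q ^ j) powr a)"
    and S: "\<And>y. y \<in> S \<Longrightarrow> y \<noteq> x \<Longrightarrow> \<exists>j. r * q ^ j / 2 \<le> dist x y \<and> dist x y < r * q ^ j"
  shows "(\<integral>\<^sup>+y\<in>S. riesz_bound d (dist x y) * ennreal (f y) \<partial>\<mu>)
     \<le> ennreal (2 powr (d - 2) * (C + 1) * \<tau> * r powr (2 + (a - d) / p)
                 / (1 - q powr (2 + (a - d) / p)))"
proof -
  define \<beta> where "\<beta> = 2 + (a - d) / p"
  define T where "T j = {y. r * q ^ j / 2 \<le> dist x y \<and> dist x y < r * q ^ j}" for j
  have [measurable]: "T j \<in> sets \<mu>" for j
  proof -
    have "{y \<in> space \<mu>. r * q ^ j / 2 \<le> dist x y \<and> dist x y < r * q ^ j} \<in> sets \<mu>" by measurable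
    then show ?thesis by (simp add: T_def space_eq)
  qed
  let ?g = "\<lambda>y. riesz_bound d (dist x y) * ennreal (f y)"
  let ?K = "2 powr (d - 2) * (C + 1) * \<tau>"
  have "(\<integral>\<^sup>+y\<in>S. ?g y \<partial>\<mu>) \<le> (\<integral>\<^sup>+y. (\<Sum>j. ?g y * indicator (T j) y) \<partial>\<mu>)"
  proof (rule nn_integral_mono_AE, use AE_neq[of x] in eventually_elim)
    case (elim y)
    show ?case
    proof (cases "y \<in> S")
      case True
      then obtain j where "y \<in> T j" using S elim by (auto simp: T_def)
      then have "?g y * indicator S y = (\<Sum>k\<in>{j}. ?g y * indicator (T k) y)"
        using True by simp
      also have "\<dots> \<le> (\<Sum>j. ?g y * indicator (T j) y)"
        by (rule sum_le_suminf) auto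
      finally show ?thesis .
    qed auto
  qed
  also have "\<dots> = (\<Sum>j. \<integral>\<^sup>+y\<in>T j. ?g y \<partial>\<mu>)"
    by (rule nn_integral_suminf) measurable
  also have "\<dots> \<le> (\<Sum>j. ennreal (?K * (r * q ^ j) powr \<beta>))"
  proof (rule suminf_le)
    fix j
    show "(\<integral>\<^sup>+y\<in>T j. ?g y \<partial>\<mu>) \<le> ennreal (?K * (r * q ^ j) powr \<beta>)"
      unfolding T_def \<beta>_def
      by (rule riesz_annulus_le) (use assms in auto)
  qed auto
  also have "\<dots> = ennreal (?K * r powr \<beta> / (1 - q powr \<beta>))"
  proof (rule suminf_ennreal_eq)
    show "0 \<le> ?K * (r * q ^ j) powr \<beta>" for j using \<open>0 < \<tau>\<close> C_pos by simp
    have eq: "?K * (r * q ^ j) powr \<beta> = ?K * r powr \<beta> * (q powr \<beta>) ^ j" for j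
    proof -
      have "(q ^ j) powr \<beta> = (q powr \<beta>) ^ j"
        using \<open>0 < q\<close> by (simp add: powr_realpow[symmetric] powr_powr mult.commute)
      then show ?thesis using \<open>0 < q\<close> \<open>0 < r\<close> by (simp add: powr_mult)
    qed
    have "(\<lambda>j. (q powr \<beta>) ^ j) sums (1 / (1 - q powr \<beta>))"
      by (rule geometric_sums) (use q in \<open>simp add: \<beta>_def\<close>)
    from sums_mult[OF this, of "?K * r powr \<beta>"]
    show "(\<lambda>j. ?K * (r * q ^ j) powr \<beta>) sums (?K * r powr \<beta> / (1 - q powr \<beta>))"
      unfolding eq by simp
  qed
  finally show ?thesis unfolding \<beta>_def .
qed

text \<open>
  If the mass of \<open>f\<^sup>p\<close> in every ball of radius \<open>r \<le> R\<close> about \<open>x\<close> were at most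
  \<open>\<tau> r\<^sup>s\<close>, the balls below radius \<open>R\<close> would contribute at most \<open>1/3\<close> to \<open>c\<close> times
  the potential at \<open>x\<close>, because \<open>s > d - 2p\<close> makes the exponent \<open>2 + (s - d)/p\<close> positive;
  the remaining part contributes at most \<open>1/3\<close> because \<open>d > 2p\<close> and the total mass is small.
  The constants depend neither on \<open>f\<close> nor on \<open>x\<close>.
\<close>
lemma large_potential_imp_concentration:
  fixes p s R c :: real
  assumes p: "1 \<le> p" "2 * p < d" and s: "d - 2 * p < s" and "0 < R" and "0 < c"
  shows "\<exists>\<tau>>0. \<exists>N>0. \<forall>f x. f \<in> borel_measurable \<mu> \<longrightarrow> (\<forall>y. 0 \<le> f y) \<longrightarrow>
     (\<integral>\<^sup>+y. ennreal (f y powr p) \<partial>\<mu>) < ennreal N \<longrightarrow>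
     1 \<le> ennreal c * (\<integral>\<^sup>+y. riesz_bound d (dist x y) * ennreal (f y) \<partial>\<mu>) \<longrightarrow>
     (\<exists>r>0. r \<le> R \<and> ennreal (\<tau> * r powr s) < (\<integral>\<^sup>+y\<in>ball x r. ennreal (f y powr p) \<partial>\<mu>))"
proof -
  have d2: "2 < d" using p by linarith
  define \<beta> \<gamma> where "\<beta> = 2 + (s - d) / p" and "\<gamma> = 2 + (0 - d) / p"
  have \<beta>: "0 < \<beta>" using p s by (simp add: \<beta>_def field_simps)
  have \<gamma>: "\<gamma> < 0" using p by (simp add: \<gamma>_def field_simps)
  define K where "K = 2 powr (d - 2) * (C + 1)"
  have K: "0 < K" using C_pos by (simp add: K_def)
  define A where "A = c * (K * R powr \<beta> / (1 - (1/2) powr \<beta>))"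
  define B where "B = c * (K * (2 * R) powr \<gamma> / (1 - 2 powr \<gamma>))"
  have half: "(1/2) powr \<beta> < (1::real)"
    using powr_less_mono2[of \<beta> "1/2" 1] \<beta> by simp
  have two: "2 powr \<gamma> < (1::real)"
    using powr_less_mono[of \<gamma> 0 2] \<gamma> by simp
  have A: "0 < A" using assms K half by (simp add: A_def)
  have B: "0 < B" using assms K two by (simp add: B_def)
  define \<tau> \<sigma> where "\<tau> = 1 / (3 * A)" and "\<sigma> = 1 / (3 * B)"
  have \<tau>: "0 < \<tau>" and \<sigma>: "0 < \<sigma>" using A B by (simp_all add: \<tau>_def \<sigma>_def)
  have "\<exists>r>0. r \<le> R \<and> ennreal (\<tau> powr p * r powr s) < (\<integral>\<^sup>+y\<in>ball x r. ennreal (f y powr p) \<partial>\<mu>)"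
    if f[measurable]: "f \<in> borel_measurable \<mu>" and f0: "\<And>y. 0 \<le> f y"
      and small: "(\<integral>\<^sup>+y. ennreal (f y powr p) \<partial>\<mu>) < ennreal (\<sigma> powr p)"
      and ge: "1 \<le> ennreal c * (\<integral>\<^sup>+y. riesz_bound d (dist x y) * ennreal (f y) \<partial>\<mu>)"
    for f :: "'a \<Rightarrow> real" and x
  proof (rule ccontr)
    assume "\<not> ?thesis"
    then have conc: "(\<integral>\<^sup>+y\<in>ball x r. ennreal (f y powr p) \<partial>\<mu>) \<le> ennreal (\<tau> powr p * r powr s)"
      if "0 < r" "r \<le> R" for r using that by (meson not_le)
    let ?g = "\<lambda>y. riesz_bound d (dist x y) * ennreal (f y)"
    have "(\<integral>\<^sup>+y\<in>ball x R. ?g y \<partial>\<mu>) \<le> ennreal (2 powr (d - 2) * (C + 1) * \<tau> * R powr (2 + (s - d) / p)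
                 / (1 - (1/2) powr (2 + (s - d) / p)))"
    proof (rule riesz_potential_dyadic_le[OF f f0 \<tau>])
      show "(\<integral>\<^sup>+y\<in>ball x (R * (1/2) ^ j). ennreal (f y powr p) \<partial>\<mu>)
          \<le> ennreal (\<tau> powr p * (R * (1/2) ^ j) powr s)" for j
        by (rule conc) (use \<open>0 < R\<close> in \<open>auto intro: mult_left_le power_le_one\<close>)
      show "\<exists>j. R * (1/2) ^ j / 2 \<le> dist x y \<and> dist x y < R * (1/2) ^ j"
        if "y \<in> ball x R" "y \<noteq> x" for y
        by (rule dyadic_decreasing) (use that in auto)
    qed (use p d2 \<open>0 < R\<close> half in \<open>auto simp: \<beta>_def\<close>)
    also have "2 powr (d - 2) * (C + 1) * \<tau> * R powr (2 + (s - d) / p)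
                 / (1 - (1/2) powr (2 + (s - d) / p)) = \<tau> * A / c"
      using \<open>0 < c\<close> unfolding A_def K_def \<beta>_def by simp
    also have "\<dots> = 1 / (3 * c)" using A by (simp add: \<tau>_def)
    finally have near: "(\<integral>\<^sup>+y\<in>ball x R. ?g y \<partial>\<mu>) \<le> ennreal (1 / (3 * c))" .
    have "(\<integral>\<^sup>+y\<in>- ball x R. ?g y \<partial>\<mu>) \<le> ennreal (2 powr (d - 2) * (C + 1) * \<sigma> * (2 * R) powr (2 + (0 - d) / p)
                 / (1 - 2 powr (2 + (0 - d) / p)))"
    proof (rule riesz_potential_dyadic_le[OF f f0 \<sigma>])
      show "(\<integral>\<^sup>+y\<in>ball x ((2 * R) * 2 ^ j). ennreal (f y powr p) \<partial>\<mu>)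
          \<le> ennreal (\<sigma> powr p * ((2 * R) * 2 ^ j) powr 0)" for j
      proof -
        have "(\<integral>\<^sup>+y\<in>ball x ((2 * R) * 2 ^ j). ennreal (f y powr p) \<partial>\<mu>)
            \<le> (\<integral>\<^sup>+y. ennreal (f y powr p) \<partial>\<mu>)"
          by (intro nn_integral_mono) (auto split: split_indicator)
        also have "\<dots> \<le> ennreal (\<sigma> powr p)" using small by simp
        finally show ?thesis using \<open>0 < R\<close> by simp
      qed
      show "\<exists>j. (2 * R) * 2 ^ j / 2 \<le> dist x y \<and> dist x y < (2 * R) * 2 ^ j"
        if "y \<in> - ball x R" "y \<noteq> x" for y
        by (rule dyadic_increasing) (use that \<open>0 < R\<close> in auto)
    qed (use p d2 \<open>0 < R\<close> two in \<open>auto simp: \<gamma>_def\<close>)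
    also have "2 powr (d - 2) * (C + 1) * \<sigma> * (2 * R) powr (2 + (0 - d) / p)
                 / (1 - 2 powr (2 + (0 - d) / p)) = \<sigma> * B / c"
      using \<open>0 < c\<close> unfolding B_def K_def \<gamma>_def by simp
    also have "\<dots> = 1 / (3 * c)" using B by (simp add: \<sigma>_def)
    finally have far: "(\<integral>\<^sup>+y\<in>- ball x R. ?g y \<partial>\<mu>) \<le> ennreal (1 / (3 * c))" .
    have "(\<integral>\<^sup>+y. ?g y \<partial>\<mu>) = (\<integral>\<^sup>+y. ?g y * indicator (ball x R) y + ?g y * indicator (- ball x R) y \<partial>\<mu>)"
      by (intro nn_integral_cong) (auto split: split_indicator)
    also have "\<dots> = (\<integral>\<^sup>+y\<in>ball x R. ?g y \<partial>\<mu>) + (\<integral>\<^sup>+y\<in>- ball x R. ?g y \<partial>\<mu>)"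
      by (rule nn_integral_add) measurable
    also have "\<dots> \<le> ennreal (1 / (3 * c)) + ennreal (1 / (3 * c))" by (rule add_mono[OF near far])
    also have "\<dots> = ennreal (2 / (3 * c))" using \<open>0 < c\<close> by (simp flip: ennreal_plus)
    finally have "ennreal c * (\<integral>\<^sup>+y. ?g y \<partial>\<mu>) \<le> ennreal c * ennreal (2 / (3 * c))"
      by (intro mult_left_mono) auto
    also have "\<dots> = ennreal (2 / 3)" using \<open>0 < c\<close> by (simp flip: ennreal_mult')
    finally have "1 \<le> ennreal (2 / 3)" using ge by (rule order_trans[rotated])
    then show False by (simp add: ennreal_1[symmetric] del: ennreal_1)
  qed
  moreover have "0 < \<tau> powr p" "0 < \<sigma> powr p" using \<tau> \<sigma> by auto
  ultimately show ?thesis by blast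
qed

text \<open>
  Around each point of \<open>K\<close> a ball of some radius \<open>r\<close> carries \<open>f\<^sup>p\<close>-mass more than
  \<open>\<tau> r\<^sup>s\<close>.  Disjoint such balls whose triples cover \<open>K\<close> have \<open>\<Sum> r\<^sup>s\<close> at most
  \<open>1/\<tau>\<close> times the total mass, which is arbitrarily small.
\<close>
lemma hausdorff_premeasure_null_subcritical:
  fixes p s c \<delta> :: real
  assumes p: "1 \<le> p" "2 * p < d" and s: "d - 2 * p < s" and "0 < c" and "0 < \<delta>" and "compact K"
    and small: "\<And>e. 0 < e \<Longrightarrow> \<exists>f\<in>borel_measurable \<mu>. (\<forall>y. 0 \<le> f y) \<and>
            (\<integral>\<^sup>+y. ennreal (f y powr p) \<partial>\<mu>) < ennreal e \<and>
            (\<forall>x\<in>K. 1 \<le> ennreal c * (\<integral>\<^sup>+y. riesz_bound d (dist x y) * ennreal (f y) \<partial>\<mu>))"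
  shows "hausdorff_premeasure (\<lambda>r. r powr s) \<delta> K = 0"
proof -
  \<comment> \<open>Tripled balls of radius at most \<open>R\<close> have diameter at most \<open>6 R < \<delta>\<close>.\<close>
  define R where "R = \<delta> / 7"
  have R: "0 < R" using \<open>0 < \<delta>\<close> by (simp add: R_def)
  have s0: "0 < s" using p s by linarith
  obtain \<tau> N where \<tau>: "0 < \<tau>" and N: "0 < N" and conc:
    "\<And>f x. f \<in> borel_measurable \<mu> \<Longrightarrow> (\<forall>y. 0 \<le> f y) \<Longrightarrow>
     (\<integral>\<^sup>+y. ennreal (f y powr p) \<partial>\<mu>) < ennreal N \<Longrightarrow>
     1 \<le> ennreal c * (\<integral>\<^sup>+y. riesz_bound d (dist x y) * ennreal (f y) \<partial>\<mu>) \<Longrightarrow>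
     (\<exists>r>0. r \<le> R \<and> ennreal (\<tau> * r powr s) < (\<integral>\<^sup>+y\<in>ball x r. ennreal (f y powr p) \<partial>\<mu>))"
    using large_potential_imp_concentration[OF p s R \<open>0 < c\<close>] by blast
  have "hausdorff_premeasure (\<lambda>r. r powr s) \<delta> K \<le> 0 + ennreal e" if "0 < e" for e
  proof -
    \<comment> \<open>The second entry of the minimum compensates for the constant \<open>6\<^sup>s / \<tau>\<close> of the covering estimate.\<close>
    define e' where "e' = min N (e * \<tau> / 6 powr s)"
    have "0 < e'" using \<open>0 < e\<close> \<tau> N by (simp add: e'_def)
    then obtain f where f[measurable]: "f \<in> borel_measurable \<mu>" and f0: "\<forall>y. 0 \<le> f y"
      and fe: "(\<integral>\<^sup>+y. ennreal (f y powr p) \<partial>\<mu>) < ennreal e'"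
      and fK: "\<And>x. x \<in> K \<Longrightarrow> 1 \<le> ennreal c * (\<integral>\<^sup>+y. riesz_bound d (dist x y) * ennreal (f y) \<partial>\<mu>)"
      using small by blast
    have "(\<integral>\<^sup>+y. ennreal (f y powr p) \<partial>\<mu>) < ennreal N"
      by (rule less_le_trans[OF fe]) (simp add: e'_def ennreal_leI)
    from conc[OF f f0 this fK] have "\<forall>x\<in>K. \<exists>r. 0 < r \<and> r \<le> R \<and>
        ennreal (\<tau> * r powr s) < (\<integral>\<^sup>+y\<in>ball x r. ennreal (f y powr p) \<partial>\<mu>)" by blast
    then obtain r where r: "\<And>x. x \<in> K \<Longrightarrow> 0 < r x \<and> r x \<le> R \<and>
        ennreal (\<tau> * r x powr s) < (\<integral>\<^sup>+y\<in>ball x (r x). ennreal (f y powr p) \<partial>\<mu>)"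
      by metis
    obtain I where I: "I \<subseteq> K" "finite I" "K \<subseteq> (\<Union>x\<in>I. ball x (r x))"
      using compact_finite_ball_subcover[OF \<open>compact K\<close>, of r] r by blast
    obtain J where J: "J \<subseteq> I" "disjoint_family_on (\<lambda>x. ball x (r x)) J"
      "(\<Union>x\<in>I. ball x (r x)) \<subseteq> (\<Union>x\<in>J. ball x (3 * r x))"
      using finite_Vitali_covering[OF \<open>finite I\<close>, of "\<lambda>x. x" r] by blast
    have finJ: "finite J" and JK: "J \<subseteq> K" using I J(1) finite_subset by auto
    have "hausdorff_premeasure (\<lambda>r. r powr s) \<delta> K \<le> (\<Sum>x\<in>J. ennreal ((2 * (3 * r x)) powr s))"
    proof (rule hausdorff_premeasure_ball_cover[OF finJ])
      show "K \<subseteq> (\<Union>x\<in>J. ball x (3 * r x))" using I(3) J(3) by blast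
      show "mono_on {0..} (\<lambda>r. r powr s)"
        using s0 by (auto intro!: mono_onI powr_mono2)
      show "0 \<le> 3 * r x" if "x \<in> J" for x using r JK that by force
      show "2 * (3 * r x) < \<delta>" if "x \<in> J" for x
        using r[of x] JK that \<open>0 < \<delta>\<close> by (force simp: R_def)
    qed
    also have "\<dots> = (\<Sum>x\<in>J. ennreal (6 powr s / \<tau>) * ennreal (\<tau> * r x powr s))"
    proof (rule sum.cong)
      fix x assume "x \<in> J"
      then have "0 < r x" using r JK by blast
      then show "ennreal ((2 * (3 * r x)) powr s) = ennreal (6 powr s / \<tau>) * ennreal (\<tau> * r x powr s)"
        using \<tau> by (simp add: powr_mult flip: ennreal_mult')
    qed simp
    also have "\<dots> \<le> (\<Sum>x\<in>J. ennreal (6 powr s / \<tau>) * (\<integral>\<^sup>+y\<in>ball x (r x). ennreal (f y powr p) \<partial>\<mu>))"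
      by (rule sum_mono, rule mult_left_mono) (use r JK in \<open>auto intro!: less_imp_le[of "ennreal _"]\<close>)
    also have "\<dots> = ennreal (6 powr s / \<tau>) * (\<Sum>x\<in>J. \<integral>\<^sup>+y\<in>ball x (r x). ennreal (f y powr p) \<partial>\<mu>)"
      by (simp add: sum_distrib_left)
    also have "(\<Sum>x\<in>J. \<integral>\<^sup>+y\<in>ball x (r x). ennreal (f y powr p) \<partial>\<mu>)
        = (\<integral>\<^sup>+y. (\<Sum>x\<in>J. ennreal (f y powr p) * indicator (ball x (r x)) y) \<partial>\<mu>)"
      by (rule nn_integral_sum[symmetric]) measurable
    also have "\<dots> = (\<integral>\<^sup>+y\<in>(\<Union>x\<in>J. ball x (r x)). ennreal (f y powr p) \<partial>\<mu>)"
      by (intro nn_integral_cong)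
        (simp only: sum_distrib_left[symmetric] indicator_UN_disjoint[OF finJ J(2)])
    also have "\<dots> \<le> (\<integral>\<^sup>+y. ennreal (f y powr p) \<partial>\<mu>)"
      by (intro nn_integral_mono) (auto split: split_indicator)
    also have "\<dots> \<le> ennreal (e * \<tau> / 6 powr s)"
      by (rule order_trans[OF less_imp_le[OF fe]]) (simp add: e'_def ennreal_leI)
    also have "ennreal (6 powr s / \<tau>) * ennreal (e * \<tau> / 6 powr s) = ennreal e"
      using \<tau> \<open>0 < e\<close> by (simp flip: ennreal_mult')
    finally show ?thesis by (simp add: mult_left_mono)
  qed
  then have "hausdorff_premeasure (\<lambda>r. r powr s) \<delta> K \<le> 0" by (rule ennreal_le_epsilon)
  then show ?thesis by simp
qed

end

section \<open>The critical dimension and logarithmic energy\<close>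

text \<open>
  Up to the factor \<open>ln 2\<close>, \<open>- ln r\<close> dominates the number of \<open>j \<ge> 1\<close> with
  \<open>r \<le> 2\<^bsup>-j\<^esup>\<close>, and integrating the indicator of \<open>[0, 2\<^bsup>-j\<^esup>]\<close> against
  \<open>dh\<close> gives \<open>h (2\<^bsup>-j\<^esup>)\<close>.
\<close>
lemma hausdorff_function_dyadic_summable:
  assumes h: "hausdorff_function h" and fin: "log_stieltjes_integral h < \<infinity>"
  shows "summable (\<lambda>j. h ((1/2) ^ j))"
proof -
  define F where "F = (\<lambda>r. if r < 0 then 0 else h r)"
  define M where "M = interval_measure F"
  define \<phi> :: "real \<Rightarrow> ennreal" where
    "\<phi> r = (if r = 0 then \<infinity> else ennreal (- ln r)) * indicator {0..1} r" for r
  have sets_M [measurable_cong]: "sets M = sets borel" by (simp add: M_def)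
  have h0: "0 \<le> h r" if "0 \<le> r" for r
    using h that by (cases "r = 0") (auto simp: hausdorff_function_def less_imp_le)
  have monoF: "F x \<le> F y" if "x \<le> y" for x y
    using that h h0 by (auto simp: F_def hausdorff_function_def mono_on_def)
  have contF: "continuous (at_right a) F" for a
  proof (cases "a < 0")
    case True
    have "eventually (\<lambda>x. F x = 0) (at_right a)"
      using eventually_at_right_less[of a] eventually_at_right[OF True] True
      by (auto simp: F_def eventually_at_right[OF True])
    then show ?thesis using True
      by (simp add: continuous_within F_def tendsto_eventually)
  next
    case False
    then have "continuous (at_right a) h" using h by (auto simp: hausdorff_function_def)
    then have "(h \<longlongrightarrow> F a) (at_right a)" using False by (simp add: continuous_within F_def)
    moreover have "eventually (\<lambda>x. h x = F x) (at_right a)"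
      using eventually_at_right_less[of a] by eventually_elim (use False in \<open>simp add: F_def\<close>)
    ultimately show ?thesis unfolding continuous_within using Lim_transform_eventually by blast
  qed
  have em: "emeasure M {-1<..b} = ennreal (F b)" if "-1 \<le> b" for b
    using emeasure_interval_measure_Ioc[OF that monoF contF] by (simp add: M_def F_def)
  \<comment> \<open>The intervals below start at \<open>-1\<close> so as to include the atom of \<open>dh\<close> at the origin.\<close>
  have "emeasure M {-1<..<0} = 0"
  proof -
    have "{-1<..<0} = (\<Union>n. {-1<..- (1 / real (Suc n))})"
    proof (intro equalityI subsetI)
      fix x :: real assume x: "x \<in> {-1<..<0}"
      then obtain n where "1 / real (Suc n) < - x"
        using nat_approx_posE[of "- x"] by auto
      then show "x \<in> (\<Union>n. {-1<..- (1 / real (Suc n))})" using x by (intro UN_I[of n]) auto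
    next
      fix x :: real assume "x \<in> (\<Union>n. {-1<..- (1 / real (Suc n))})"
      then obtain n where "-1 < x" "x \<le> - (1 / real (Suc n))" by auto
      moreover have "0 < 1 / real (Suc n)" by simp
      ultimately have "x < 0" by linarith
      with \<open>-1 < x\<close> show "x \<in> {-1<..<0}" by simp
    qed
    moreover have "emeasure M (\<Union>n. {-1<..- (1 / real (Suc n))}) = 0"
    proof (rule emeasure_UN_eq_0)
      show "emeasure M {-1<..- (1 / real (Suc n))} = 0" for n
        by (subst em) (auto simp: F_def)
    qed (auto simp: sets_M)
    ultimately show ?thesis by simp
  qed
  then have AE: "AE r in M. r \<notin> {-1<..<0}"
    by (intro AE_I[of _ _ "{-1<..<0}"]) (auto simp: sets_M)
  have fin': "(\<integral>\<^sup>+r. \<phi> r \<partial>M) < \<infinity>"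
    using fin by (simp add: log_stieltjes_integral_def M_def F_def \<phi>_def)
  define L where "L = enn2real (\<integral>\<^sup>+r. \<phi> r \<partial>M)"
  have L: "(\<integral>\<^sup>+r. \<phi> r \<partial>M) = ennreal L"
    using fin' by (simp add: L_def)
  have bound: "(\<Sum>j<n. h ((1/2) ^ Suc j)) \<le> L / ln 2" for n
  proof -
    have count: "ennreal (ln 2) * (\<Sum>j<n. indicator {-1<..(1/2) ^ Suc j} r) \<le> \<phi> r"
      if "r \<notin> {-1<..<0}" for r :: real
    proof (cases "0 < r \<and> r \<le> 1")
      case True
      define k where "k = nat \<lfloor>- ln r / ln 2\<rfloor>"
      have nn: "0 \<le> - ln r / ln 2" using True by (simp add: divide_nonpos_pos)
      have "j < k" if "r \<le> (1/2) ^ Suc j" for j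
      proof -
        have "ln r \<le> ln ((1/2) ^ Suc j)" using True that by (subst ln_le_cancel_iff) auto
        also have "\<dots> = real (Suc j) * ln (1/2)" by (rule ln_realpow)
        also have "ln (1/2) = - ln (2::real)" by (simp add: ln_div)
        finally have "real (Suc j) * ln 2 \<le> - ln r" by simp
        then have "real (Suc j) \<le> - ln r / ln 2" by (simp add: field_simps)
        then have "int (Suc j) \<le> \<lfloor>- ln r / ln 2\<rfloor>" by (simp add: le_floor_iff)
        then show ?thesis by (simp add: k_def)
      qed
      then have "indicator {-1<..(1/2) ^ Suc j} r \<le> (indicator {..<k} j :: ennreal)" for j
        by (auto split: split_indicator)
      then have "(\<Sum>j<n. indicator {-1<..(1/2) ^ Suc j} r) \<le> (\<Sum>j<n. indicator {..<k} j :: ennreal)"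
        by (rule sum_mono)
      also have "\<dots> = of_nat (card ({..<n} \<inter> {..<k}))"
        by (simp add: indicator_def[abs_def] sum.If_cases Int_def lessThan_def)
      also have "\<dots> \<le> of_nat (card {..<k})"
        by (intro of_nat_mono card_mono) auto
      also have "\<dots> = ennreal (real k)" by (simp add: ennreal_of_nat_eq_real_of_nat)
      also have "\<dots> \<le> ennreal (- ln r / ln 2)"
        using nn by (intro ennreal_leI) (simp add: k_def)
      finally have "ennreal (ln 2) * (\<Sum>j<n. indicator {-1<..(1/2) ^ Suc j} r)
          \<le> ennreal (ln 2) * ennreal (- ln r / ln 2)"
        by (intro mult_left_mono) auto
      also have "\<dots> = ennreal (- ln r)" by (simp flip: ennreal_mult')
      finally show ?thesis using True by (simp add: \<phi>_def)
    next
      case False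
      show ?thesis
      proof (cases "r = 0")
        case True
        then show ?thesis by (simp add: \<phi>_def)
      next
        case neq: False
        have "indicator {-1<..(1/2) ^ Suc j} r = (0::ennreal)" for j
        proof -
          have "(1/2) ^ Suc j \<le> (1::real)" by (rule power_le_one) auto
          then show ?thesis using False neq that by (auto split: split_indicator)
        qed
        then show ?thesis by simp
      qed
    qed
    have eqh: "ennreal (h ((1/2) ^ Suc j)) = emeasure M {-1<..(1/2) ^ Suc j}" for j
    proof -
      have "(0::real) \<le> (1/2) ^ Suc j" by (rule zero_le_power) simp
      then have "-1 \<le> (1/2::real) ^ Suc j" and "\<not> (1/2::real) ^ Suc j < 0" by linarith+
      then show ?thesis unfolding em[OF \<open>-1 \<le> (1/2) ^ Suc j\<close>] F_def by (simp only: if_False)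
    qed
    have "ennreal (ln 2 * (\<Sum>j<n. h ((1/2) ^ Suc j)))
        = ennreal (ln 2) * (\<Sum>j<n. ennreal (h ((1/2) ^ Suc j)))"
      by (subst sum_ennreal) (auto intro!: h0 simp: ennreal_mult')
    also have "\<dots> = ennreal (ln 2) * (\<Sum>j<n. \<integral>\<^sup>+r. indicator {-1<..(1/2) ^ Suc j} r \<partial>M)"
      unfolding eqh by (simp add: sets_M)
    also have "\<dots> = (\<integral>\<^sup>+r. ennreal (ln 2) * (\<Sum>j<n. indicator {-1<..(1/2) ^ Suc j} r) \<partial>M)"
      by (subst nn_integral_cmult, measurable, subst nn_integral_sum) auto
    also have "\<dots> \<le> (\<integral>\<^sup>+r. \<phi> r \<partial>M)"
      by (rule nn_integral_mono_AE, use AE in eventually_elim) (rule count)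
    also have "\<dots> = ennreal L" by (rule L)
    finally have "ln 2 * (\<Sum>j<n. h ((1/2) ^ Suc j)) \<le> L"
      by (subst (asm) ennreal_le_iff) (simp add: L_def)
    then show ?thesis by (simp add: field_simps)
  qed
  have "summable (\<lambda>j. h ((1/2) ^ Suc j))"
    by (rule summableI_nonneg_bounded[of _ "L / ln 2"]) (use bound in \<open>auto intro!: h0\<close>)
  then show ?thesis using summable_Suc_iff[of "\<lambda>j. h ((1/2) ^ j)"] by simp
qed

lemma square_sum_le:
  fixes a :: "nat \<Rightarrow> real"
  assumes "\<And>j. 0 \<le> a j"
  shows "(\<Sum>j\<le>N. a j)\<^sup>2 \<le> 2 * (\<Sum>l\<le>N. a l * (\<Sum>j\<le>l. a j))"
proof (induction N)
  case 0
  then show ?case by (simp add: power2_eq_square)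
next
  case (Suc N)
  define S where "S = (\<Sum>j\<le>N. a j)"
  have "(S + a (Suc N))\<^sup>2 \<le> S\<^sup>2 + 2 * (a (Suc N) * (S + a (Suc N)))"
    by (simp add: power2_eq_square algebra_simps)
  with Suc show ?case unfolding S_def by simp
qed

text \<open>
  Interchanging the sums leaves \<open>\<Sum>\<^bsub>l \<ge> j\<^esub> 4\<^bsup>j-l\<^esup> \<le> 4/3\<close>.  In the proof, the
  tails of these geometric series beyond \<open>N\<close> are kept as an extra term, which makes it an identity
  that induction can handle.
\<close>
lemma geometric_double_sum_le:
  fixes m :: "nat \<Rightarrow> real"
  assumes "\<And>j. 0 \<le> m j"
  shows "(\<Sum>l\<le>N. (1/4) ^ l * (\<Sum>j\<le>l. 4 ^ j * m j)) \<le> 4 / 3 * (\<Sum>j\<le>N. m j)"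
proof -
  have "(\<Sum>l\<le>N. (1/4) ^ l * (\<Sum>j\<le>l. 4 ^ j * m j)) + 1 / 3 * (1/4) ^ N * (\<Sum>j\<le>N. 4 ^ j * m j)
      = 4 / 3 * (\<Sum>j\<le>N. m j)"
  proof (induction N)
    case 0
    then show ?case by simp
  next
    case (Suc N)
    define T S q P where "T = (\<Sum>l\<le>N. (1/4) ^ l * (\<Sum>j\<le>l. 4 ^ j * m j))"
      and "S = (\<Sum>j\<le>N. 4 ^ j * m j)" and "q = (1/4::real) ^ N" and "P = (4::real) ^ N"
    have "P * q = 1" by (simp add: P_def q_def flip: power_mult_distrib)
    have "T + 1 / 4 * q * (S + 4 * P * m (Suc N)) + 1 / 3 * (1 / 4 * q) * (S + 4 * P * m (Suc N))
        = (T + 1 / 3 * q * S) + 4 / 3 * (P * q) * m (Suc N)"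
      by (simp add: field_simps)
    also have "T + 1 / 3 * q * S = 4 / 3 * (\<Sum>j\<le>N. m j)"
      using Suc unfolding T_def S_def q_def .
    also have "4 / 3 * (P * q) * m (Suc N) = 4 / 3 * m (Suc N)"
      using \<open>P * q = 1\<close> by simp
    finally show ?case unfolding T_def S_def q_def P_def by (simp add: algebra_simps)
  qed
  moreover have "0 \<le> 1 / 3 * (1/4) ^ N * (\<Sum>j\<le>N. 4 ^ j * m j)"
    using assms by (intro mult_nonneg_nonneg sum_nonneg) auto
  ultimately show ?thesis by linarith
qed

text \<open>
  A truncated and discretised version of \<open>R\<^sup>2 / dist\<^sup>2\<close>.  Being a finite combination of
  indicators of balls, it turns potentials and energies into sums of masses of balls; the truncation
  keeps the energy of point masses finite.
\<close>
definition dyadic_kernel :: "real \<Rightarrow> nat \<Rightarrow> 'a::metric_space \<Rightarrow> 'a \<Rightarrow> real" where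
  "dyadic_kernel R N x y = (\<Sum>j\<le>N. 4 ^ j * indicator (ball x (R * (1/2) ^ j)) y)"

lemma dyadic_kernel_nonneg: "0 \<le> dyadic_kernel R N x y"
  unfolding dyadic_kernel_def by (intro sum_nonneg) auto

lemma dyadic_kernel_mono: "M \<le> N \<Longrightarrow> dyadic_kernel R M x y \<le> dyadic_kernel R N x y"
  unfolding dyadic_kernel_def by (intro sum_mono2) auto

lemma riesz_bound_le_dyadic_kernel:
  assumes "dist x y < R" "y \<noteq> x"
  shows "riesz_bound 4 (dist x y) \<le> ennreal (4 / R\<^sup>2) * (SUP N. ennreal (dyadic_kernel R N x y))"
proof -
  have D: "0 < dist x y" using assms by simp
  then have "0 < R" using assms by linarith
  obtain j where j: "R * (1/2) ^ j / 2 \<le> dist x y" "dist x y < R * (1/2) ^ j"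
    using dyadic_decreasing[OF D assms(1)] by blast
  have "dist x y powr (-2) \<le> (R * (1/2) ^ j / 2) powr (-2)"
    using j \<open>0 < R\<close> by (intro powr_mono2') auto
  also have "\<dots> = 4 / R\<^sup>2 * 4 ^ j"
    using \<open>0 < R\<close>
    by (simp add: powr_minus powr_numeral field_simps power_mult_distrib power_divide
        flip: power_mult power_even_eq) (simp add: power_mult power_even_eq power2_eq_square mult.commute[of j])
  finally have "riesz_bound 4 (dist x y) \<le> ennreal (4 / R\<^sup>2) * ennreal (4 ^ j)"
    using D by (simp add: riesz_bound_def ennreal_leI flip: ennreal_mult')
  also have "ennreal (4 ^ j) \<le> ennreal (dyadic_kernel R j x y)"
  proof (rule ennreal_leI)
    have "4 ^ j = (\<Sum>i\<in>{j}. 4 ^ i * indicator (ball x (R * (1/2) ^ i)) y :: real)"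
      using j by simp
    also have "\<dots> \<le> dyadic_kernel R j x y"
      unfolding dyadic_kernel_def by (intro sum_mono2) auto
    finally show "4 ^ j \<le> dyadic_kernel R j x y" .
  qed
  also have "\<dots> \<le> (SUP N. ennreal (dyadic_kernel R N x y))" by (rule SUP_upper) simp
  finally show ?thesis by (simp add: mult_left_mono)
qed

text \<open>
  A Harnack type inequality below the truncation scale: moving the centre by less than the smallest
  radius is absorbed by the next larger ball, at the cost of the factor 4, while the largest ball
  about the new centre contains \<open>y\<close> anyway.
\<close>
lemma dyadic_kernel_shift:
  assumes "dist x' y < R" and "dist x x' < R * (1/2) ^ N"
  shows "dyadic_kernel R N x y \<le> 5 * dyadic_kernel R N x' y"
proof -
  let ?k = "\<lambda>x j. 4 ^ j * indicator (ball x (R * (1/2) ^ j)) y :: real"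
  have "0 \<le> dist x' y" by simp
  then have "0 < R" using assms(1) by linarith
  have split: "dyadic_kernel R N z y = ?k z 0 + (\<Sum>j<N. ?k z (Suc j))" for z
    unfolding dyadic_kernel_def lessThan_Suc_atMost[symmetric] by (rule sum.lessThan_Suc_shift)
  have step: "?k x (Suc j) \<le> 4 * ?k x' j" if "j < N" for j
  proof (cases "dist x y < R * (1/2) ^ Suc j")
    case True
    have "(1/2) ^ N \<le> (1/2 :: real) ^ Suc j" using that by (intro power_decreasing) auto
    then have "R * (1/2) ^ N \<le> R * (1/2) ^ Suc j" using \<open>0 < R\<close> by (intro mult_left_mono) auto
    moreover have "dist x' y \<le> dist x x' + dist x y" by (rule dist_triangle3[of x' y x, simplified dist_commute[of x' x]])
    ultimately have "dist x' y < R * (1/2) ^ j" using True assms(2) by simp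
    then show ?thesis by (simp split: split_indicator)
  qed (auto split: split_indicator)
  have first: "?k x 0 \<le> ?k x' 0" using assms(1) by (auto split: split_indicator)
  have "(\<Sum>j<N. ?k x (Suc j)) \<le> (\<Sum>j<N. 4 * ?k x' j)" by (intro sum_mono step) auto
  also have "\<dots> = 4 * (\<Sum>j<N. ?k x' j)" by (rule sum_distrib_left[symmetric])
  also have "(\<Sum>j<N. ?k x' j) \<le> dyadic_kernel R N x' y"
    unfolding dyadic_kernel_def by (intro sum_mono2) auto
  finally have "(\<Sum>j<N. ?k x (Suc j)) \<le> 4 * dyadic_kernel R N x' y" by simp
  moreover have "?k x' 0 \<le> dyadic_kernel R N x' y"
    unfolding split[of x'] by (simp add: sum_nonneg)
  ultimately show ?thesis using first unfolding split[of x] by linarith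
qed

context upper_regular_measure
begin

lemma measurable_dyadic_kernel [measurable]:
  "(\<lambda>y. dyadic_kernel R N x y) \<in> borel_measurable \<mu>"
  unfolding dyadic_kernel_def by measurable

text \<open>
  Each point has its own truncation level, by monotone convergence.  The comparison of kernels at
  neighbouring points makes that level valid in a whole ball, and finitely many balls suffice.
\<close>
lemma compact_uniform_dyadic_potential:
  fixes f :: "'a \<Rightarrow> real"
  assumes [measurable]: "f \<in> borel_measurable \<mu>" and f: "\<And>y. 0 \<le> f y"
    and "0 < c" and diam: "\<And>x y :: 'a. dist x y < R" and "compact K"
    and ge: "\<And>x. x \<in> K \<Longrightarrow> 1 \<le> ennreal c * (\<integral>\<^sup>+y. riesz_bound 4 (dist x y) * ennreal (f y) \<partial>\<mu>)"
  shows "\<exists>N0. \<forall>N\<ge>N0. \<forall>x\<in>K.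
     ennreal (R\<^sup>2 / (40 * c)) \<le> (\<integral>\<^sup>+y. ennreal (dyadic_kernel R N x y * f y) \<partial>\<mu>)"
proof -
  have "0 < R" using diam[of undefined undefined] by simp
  let ?P = "\<lambda>N x. \<integral>\<^sup>+y. ennreal (dyadic_kernel R N x y * f y) \<partial>\<mu>"
  have P_mono: "?P M x \<le> ?P N x" if "M \<le> N" for M N x
    using dyadic_kernel_mono[OF that] f
    by (intro nn_integral_mono ennreal_leI mult_right_mono) auto
  have "\<exists>N. ennreal (R\<^sup>2 / (8 * c)) < ?P N x" if "x \<in> K" for x
  proof (rule ccontr)
    assume "\<not> ?thesis"
    then have le: "?P N x \<le> ennreal (R\<^sup>2 / (8 * c))" for N by (meson not_le)
    have "(\<integral>\<^sup>+y. riesz_bound 4 (dist x y) * ennreal (f y) \<partial>\<mu>)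
       \<le> (\<integral>\<^sup>+y. ennreal (4 / R\<^sup>2) * (SUP N. ennreal (dyadic_kernel R N x y * f y)) \<partial>\<mu>)"
    proof (rule nn_integral_mono_AE, use AE_neq[of x] in eventually_elim)
      case (elim y)
      have "riesz_bound 4 (dist x y) * ennreal (f y)
          \<le> (ennreal (4 / R\<^sup>2) * (SUP N. ennreal (dyadic_kernel R N x y))) * ennreal (f y)"
        using riesz_bound_le_dyadic_kernel[OF diam elim] by (rule mult_right_mono) simp
      also have "\<dots> = ennreal (4 / R\<^sup>2) * (SUP N. ennreal (dyadic_kernel R N x y) * ennreal (f y))"
        by (simp add: SUP_mult_right_ennreal mult.assoc)
      also have "\<dots> = ennreal (4 / R\<^sup>2) * (SUP N. ennreal (dyadic_kernel R N x y * f y))"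
        by (simp only: ennreal_mult[OF dyadic_kernel_nonneg f])
      finally show ?case .
    qed
    also have "\<dots> = ennreal (4 / R\<^sup>2) * (\<integral>\<^sup>+y. (SUP N. ennreal (dyadic_kernel R N x y * f y)) \<partial>\<mu>)"
      by (rule nn_integral_cmult) measurable
    also have "(\<integral>\<^sup>+y. (SUP N. ennreal (dyadic_kernel R N x y * f y)) \<partial>\<mu>) = (SUP N. ?P N x)"
    proof (rule nn_integral_monotone_convergence_SUP)
      show "incseq (\<lambda>N y. ennreal (dyadic_kernel R N x y * f y))"
        by (intro incseq_SucI le_funI ennreal_leI mult_right_mono f dyadic_kernel_mono) auto
    qed measurable
    also have "\<dots> \<le> ennreal (R\<^sup>2 / (8 * c))" by (intro SUP_least le)
    finally have "ennreal c * (\<integral>\<^sup>+y. riesz_bound 4 (dist x y) * ennreal (f y) \<partial>\<mu>)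
       \<le> ennreal c * (ennreal (4 / R\<^sup>2) * ennreal (R\<^sup>2 / (8 * c)))"
      by (simp add: mult_left_mono)
    also have "\<dots> = ennreal (1 / 2)"
      using \<open>0 < c\<close> \<open>0 < R\<close> by (simp flip: ennreal_mult')
    finally have "ennreal 1 \<le> ennreal (1 / 2)"
      unfolding ennreal_1 using ge[OF that] by (rule order_trans[rotated])
    then show False by (subst (asm) ennreal_le_iff) auto
  qed
  then obtain n where n: "\<And>x. x \<in> K \<Longrightarrow> ennreal (R\<^sup>2 / (8 * c)) < ?P (n x) x" by metis
  obtain I where I: "I \<subseteq> K" "finite I" "K \<subseteq> (\<Union>x\<in>I. ball x (R * (1/2) ^ n x))"
    using compact_finite_ball_subcover[OF \<open>compact K\<close>, of "\<lambda>x. R * (1/2) ^ n x"] \<open>0 < R\<close> by auto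
  have "ennreal (R\<^sup>2 / (40 * c)) \<le> ?P N x" if N: "Max (insert 0 (n ` I)) \<le> N" and x: "x \<in> K" for N x
  proof -
    obtain z where z: "z \<in> I" "dist z x < R * (1/2) ^ n z" using I(3) x by auto
    have "n z \<le> N" using N z(1) I(2) by simp
    have "ennreal (1 / 5) * ennreal (R\<^sup>2 / (8 * c)) \<le> ennreal (1 / 5) * ?P (n z) z"
      using n[of z] z(1) I(1) by (intro mult_left_mono) auto
    also have "?P (n z) z \<le> (\<integral>\<^sup>+y. ennreal 5 * ennreal (dyadic_kernel R (n z) x y * f y) \<partial>\<mu>)"
    proof (rule nn_integral_mono)
      fix y
      have "dyadic_kernel R (n z) z y * f y \<le> (5 * dyadic_kernel R (n z) x y) * f y"
        using dyadic_kernel_shift[OF diam z(2)] f by (intro mult_right_mono)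
      then have "ennreal (dyadic_kernel R (n z) z y * f y) \<le> ennreal (5 * (dyadic_kernel R (n z) x y * f y))"
        by (intro ennreal_leI) (simp only: mult.assoc)
      then show "ennreal (dyadic_kernel R (n z) z y * f y)
          \<le> ennreal 5 * ennreal (dyadic_kernel R (n z) x y * f y)"
        by (simp add: ennreal_mult')
    qed
    also have "\<dots> = ennreal 5 * ?P (n z) x"
      by (rule nn_integral_cmult) measurable
    also have "ennreal (1 / 5) * (ennreal 5 * ?P (n z) x) = ?P (n z) x"
    proof -
      have "ennreal (1 / 5) * ennreal 5 = 1" by (subst ennreal_mult'[symmetric]) auto
      then show ?thesis by (metis mult.assoc mult_1)
    qed
    also have "\<dots> \<le> ?P N x" by (rule P_mono) fact
    finally show ?thesis using \<open>0 < c\<close> by (simp add: mult_left_mono flip: ennreal_mult')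
  qed
  then show ?thesis by blast
qed

text \<open>
  With \<open>\<nu>\<close> the discrete measure of weights \<open>w\<close>, the square of its potential expands into products
  of ball masses at two scales \<open>r\<^sub>l \<le> r\<^sub>j\<close>.  Where \<open>x\<close> lies within \<open>r\<^sub>l\<close> of \<open>z\<close>, the
  \<open>\<nu>\<close>-mass of the ball of radius \<open>r\<^sub>j\<close> about \<open>z\<close> is at most that of the ball of radius
  \<open>2 r\<^sub>j\<close> about \<open>x\<close>, hence at most \<open>m j\<close>; integrating over \<open>z\<close> then costs only
  \<open>C r\<^sub>l\<^sup>4\<close>.  The powers of the radii leave \<open>4\<^bsup>j-l\<^esup>\<close>, so the energy is controlled by
  \<open>\<Sum> m j\<close>.  This is a discrete form of the fact that, in dimension four, composing the kernel
  \<open>\<rho>\<^bsup>-2\<^esup>\<close> with itself produces at most a logarithmic singularity.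
\<close>
lemma dyadic_energy_le:
  fixes w :: "'a \<Rightarrow> real"
  assumes "d = 4" "finite X" and w: "\<And>x. 0 \<le> w x" and "0 < R" and m0: "\<And>j. 0 \<le> m j"
    and m: "\<And>x j. x \<in> X \<Longrightarrow> j \<le> N \<Longrightarrow> (\<Sum>y\<in>X \<inter> ball x (2 * (R * (1/2) ^ j)). w y) \<le> m j"
  shows "(\<integral>\<^sup>+z. ennreal ((\<Sum>x\<in>X. w x * dyadic_kernel R N x z)\<^sup>2) \<partial>\<mu>)
     \<le> ennreal (8 / 3 * C * R ^ 4 * (\<Sum>x\<in>X. w x) * (\<Sum>j\<le>N. m j))"
proof -
  define r where "r j = R * (1/2) ^ j" for j :: nat
  define \<nu> where "\<nu> j z = (\<Sum>x\<in>X. w x * indicator (ball x (r j)) z)" for j z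
  define W where "W = (\<Sum>x\<in>X. w x)"
  have r0: "0 < r j" for j using \<open>0 < R\<close> by (simp add: r_def)
  have r_dec: "r l \<le> r j" if "j \<le> l" for j l
    using that \<open>0 < R\<close> by (auto simp: r_def intro!: mult_left_mono power_decreasing)
  have \<nu>0: "0 \<le> \<nu> j z" for j z unfolding \<nu>_def using w by (intro sum_nonneg) auto
  have W0: "0 \<le> W" unfolding W_def using w by (intro sum_nonneg) auto
  have [measurable]: "\<nu> j \<in> borel_measurable \<mu>" for j unfolding \<nu>_def by measurable
  have V: "(\<Sum>x\<in>X. w x * dyadic_kernel R N x z) = (\<Sum>j\<le>N. 4 ^ j * \<nu> j z)" for z
    unfolding dyadic_kernel_def \<nu>_def r_def sum_distrib_left
    by (subst sum.swap) (simp add: mult_ac)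
  have prod: "\<nu> l z * \<nu> j z \<le> m j * \<nu> l z" if "j \<le> l" "l \<le> N" for j l z
  proof -
    have "w x * indicator (ball x (r l)) z * \<nu> j z \<le> w x * indicator (ball x (r l)) z * m j"
      if x: "x \<in> X" for x
    proof (cases "dist x z < r l")
      case True
      have "\<nu> j z = (\<Sum>y\<in>X \<inter> ball z (r j). w y)"
        unfolding \<nu>_def sum.inter_restrict[OF \<open>finite X\<close>]
        by (intro sum.cong) (auto simp: dist_commute split: split_indicator)
      also have "\<dots> \<le> (\<Sum>y\<in>X \<inter> ball x (2 * r j). w y)"
      proof (rule sum_mono2)
        show "X \<inter> ball z (r j) \<subseteq> X \<inter> ball x (2 * r j)"
        proof safe
          fix y assume "y \<in> ball z (r j)"
          moreover have "dist x y \<le> dist x z + dist z y" by (rule dist_triangle)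
          ultimately show "y \<in> ball x (2 * r j)" using True r_dec[OF \<open>j \<le> l\<close>] by simp
        qed
      qed (use \<open>finite X\<close> w in auto)
      also have "\<dots> \<le> m j" using m[OF x, of j] that \<open>j \<le> l\<close> \<open>l \<le> N\<close> by (simp add: r_def)
      finally show ?thesis using w by (intro mult_left_mono) auto
    qed auto
    then have "(\<Sum>x\<in>X. w x * indicator (ball x (r l)) z * \<nu> j z)
        \<le> (\<Sum>x\<in>X. w x * indicator (ball x (r l)) z * m j)" by (rule sum_mono)
    then show ?thesis unfolding \<nu>_def[of l] by (simp add: sum_distrib_left mult_ac)
  qed
  define b where "b l = 2 * 4 ^ l * (\<Sum>j\<le>l. 4 ^ j * m j)" for l
  have b0: "0 \<le> b l" for l
    unfolding b_def using m0 by (intro mult_nonneg_nonneg sum_nonneg) auto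
  have pw: "(\<Sum>x\<in>X. w x * dyadic_kernel R N x z)\<^sup>2 \<le> (\<Sum>l\<le>N. b l * \<nu> l z)" for z
  proof -
    have "(\<Sum>x\<in>X. w x * dyadic_kernel R N x z)\<^sup>2
        \<le> 2 * (\<Sum>l\<le>N. 4 ^ l * \<nu> l z * (\<Sum>j\<le>l. 4 ^ j * \<nu> j z))"
      unfolding V using \<nu>0 by (intro square_sum_le) auto
    also have "\<dots> \<le> 2 * (\<Sum>l\<le>N. 4 ^ l * (\<Sum>j\<le>l. 4 ^ j * (m j * \<nu> l z)))"
    proof (intro mult_left_mono sum_mono)
      fix l assume l: "l \<in> {..N}"
      have "\<nu> l z * (\<Sum>j\<le>l. 4 ^ j * \<nu> j z) = (\<Sum>j\<le>l. 4 ^ j * (\<nu> l z * \<nu> j z))"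
        by (simp add: sum_distrib_left mult_ac)
      also have "\<dots> \<le> (\<Sum>j\<le>l. 4 ^ j * (m j * \<nu> l z))"
        using l by (intro sum_mono mult_left_mono prod) auto
      finally show "4 ^ l * \<nu> l z * (\<Sum>j\<le>l. 4 ^ j * \<nu> j z) \<le> 4 ^ l * (\<Sum>j\<le>l. 4 ^ j * (m j * \<nu> l z))"
        by (simp add: mult.assoc)
    qed auto
    also have "\<dots> = (\<Sum>l\<le>N. b l * \<nu> l z)"
      by (simp add: b_def sum_distrib_left sum_distrib_right mult_ac)
    finally show ?thesis .
  qed
  have int: "(\<integral>\<^sup>+z. ennreal (\<nu> l z) \<partial>\<mu>) \<le> ennreal (C * R ^ 4 * W * (1/4) ^ l * (1/4) ^ l)" for l
  proof -
    have "(\<integral>\<^sup>+z. ennreal (\<nu> l z) \<partial>\<mu>) = (\<integral>\<^sup>+z. (\<Sum>x\<in>X. ennreal (w x) * indicator (ball x (r l)) z) \<partial>\<mu>)"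
    proof (intro nn_integral_cong)
      fix z
      have "ennreal (\<nu> l z) = (\<Sum>x\<in>X. ennreal (w x * indicator (ball x (r l)) z))"
        unfolding \<nu>_def using w by (intro sum_ennreal[symmetric]) auto
      also have "\<dots> = (\<Sum>x\<in>X. ennreal (w x) * indicator (ball x (r l)) z)"
        by (intro sum.cong) (auto split: split_indicator)
      finally show "ennreal (\<nu> l z) = (\<Sum>x\<in>X. ennreal (w x) * indicator (ball x (r l)) z)" .
    qed
    also have "\<dots> = (\<Sum>x\<in>X. ennreal (w x) * emeasure \<mu> (ball x (r l)))"
      by (subst nn_integral_sum) (auto simp: nn_integral_cmult_indicator)
    also have "\<dots> \<le> (\<Sum>x\<in>X. ennreal (w x) * ennreal (C * r l powr d))"
      by (intro sum_mono mult_left_mono ball_growth r0) auto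
    also have "\<dots> = ennreal (W * (C * r l powr d))"
      using w C_pos by (simp add: W_def sum_distrib_right sum_ennreal flip: ennreal_mult')
    also have "W * (C * r l powr d) = C * R ^ 4 * W * (1/4) ^ l * (1/4) ^ l"
    proof -
      have "r l powr d = (R * (1/2) ^ l) ^ 4"
        using r0[of l] by (simp add: \<open>d = 4\<close> r_def)
      also have "\<dots> = R ^ 4 * ((1/2) ^ 4) ^ l"
        by (simp only: power_mult_distrib power_mult[symmetric] mult.commute)
      also have "((1/2) ^ 4 :: real) ^ l = (1/4) ^ l * (1/4) ^ l"
        by (simp add: power4_eq_xxxx flip: power_mult_distrib)
      finally show ?thesis by simp
    qed
    finally show ?thesis .
  qed
  have "(\<integral>\<^sup>+z. ennreal ((\<Sum>x\<in>X. w x * dyadic_kernel R N x z)\<^sup>2) \<partial>\<mu>)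
      \<le> (\<integral>\<^sup>+z. (\<Sum>l\<le>N. ennreal (b l) * ennreal (\<nu> l z)) \<partial>\<mu>)"
  proof (rule nn_integral_mono)
    fix z
    have "ennreal ((\<Sum>x\<in>X. w x * dyadic_kernel R N x z)\<^sup>2) \<le> ennreal (\<Sum>l\<le>N. b l * \<nu> l z)"
      by (intro ennreal_leI pw)
    also have "\<dots> = (\<Sum>l\<le>N. ennreal (b l) * ennreal (\<nu> l z))"
      using b0 \<nu>0 by (simp add: ennreal_mult flip: sum_ennreal)
    finally show "ennreal ((\<Sum>x\<in>X. w x * dyadic_kernel R N x z)\<^sup>2)
        \<le> (\<Sum>l\<le>N. ennreal (b l) * ennreal (\<nu> l z))" .
  qed
  also have "\<dots> = (\<Sum>l\<le>N. ennreal (b l) * (\<integral>\<^sup>+z. ennreal (\<nu> l z) \<partial>\<mu>))"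
    by (subst nn_integral_sum) (auto simp: nn_integral_cmult)
  also have "\<dots> \<le> (\<Sum>l\<le>N. ennreal (b l) * ennreal (C * R ^ 4 * W * (1/4) ^ l * (1/4) ^ l))"
    by (intro sum_mono mult_left_mono int) auto
  also have "\<dots> = ennreal (\<Sum>l\<le>N. b l * (C * R ^ 4 * W * (1/4) ^ l * (1/4) ^ l))"
    using b0 C_pos W0 \<open>0 < R\<close> by (simp add: sum_ennreal flip: ennreal_mult')
  also have "(\<Sum>l\<le>N. b l * (C * R ^ 4 * W * (1/4) ^ l * (1/4) ^ l))
      = 2 * C * R ^ 4 * W * (\<Sum>l\<le>N. (1/4) ^ l * (\<Sum>j\<le>l. 4 ^ j * m j))"
  proof -
    have "b l * (C * R ^ 4 * W * (1/4) ^ l * (1/4) ^ l)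
        = 2 * C * R ^ 4 * W * ((1/4) ^ l * (\<Sum>j\<le>l. 4 ^ j * m j))" for l
    proof -
      have "(4::real) ^ l * (1/4) ^ l = 1" by (simp flip: power_mult_distrib)
      moreover have "b l * (C * R ^ 4 * W * (1/4) ^ l * (1/4) ^ l)
        = 2 * C * R ^ 4 * W * ((1/4) ^ l * (\<Sum>j\<le>l. 4 ^ j * m j)) * (4 ^ l * (1/4) ^ l)"
        unfolding b_def by (simp only: mult_ac)
      ultimately show ?thesis by simp
    qed
    then show ?thesis by (simp add: sum_distrib_left)
  qed
  also have "\<dots> \<le> 2 * C * R ^ 4 * W * (4 / 3 * (\<Sum>j\<le>N. m j))"
    using C_pos W0 \<open>0 < R\<close> by (intro mult_left_mono geometric_double_sum_le m0) auto
  also have "2 * C * R ^ 4 * W * (4 / 3 * (\<Sum>j\<le>N. m j)) = 8 / 3 * C * R ^ 4 * W * (\<Sum>j\<le>N. m j)"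
    by simp
  finally show ?thesis unfolding W_def by (simp add: ennreal_leI)
qed

text \<open>
  Integrating the lower bound of the potential of \<open>f\<close> against the discrete measure and exchanging
  the order of integration gives \<open>\<kappa> W \<le> \<integral> f V d\<mu>\<close>, where \<open>V\<close> is the potential of the weights;
  then the Cauchy--Schwarz inequality applies, here in the form of Young's inequality.
\<close>
lemma dyadic_potential_duality:
  fixes f w :: "'a \<Rightarrow> real"
  assumes [measurable]: "f \<in> borel_measurable \<mu>" and f: "\<And>y. 0 \<le> f y"
    and "finite X" and w: "\<And>x. 0 \<le> w x"
    and "0 < \<kappa>" and "0 < L" and "0 \<le> n" and "W = (\<Sum>x\<in>X. w x)"
    and pot: "\<And>x. x \<in> X \<Longrightarrow> ennreal \<kappa> \<le> (\<integral>\<^sup>+z. ennreal (dyadic_kernel R N x z * f z) \<partial>\<mu>)"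
    and norm: "(\<integral>\<^sup>+z. ennreal ((f z)\<^sup>2) \<partial>\<mu>) \<le> ennreal n"
    and energy: "(\<integral>\<^sup>+z. ennreal ((\<Sum>x\<in>X. w x * dyadic_kernel R N x z)\<^sup>2) \<partial>\<mu>) \<le> ennreal (L * W)"
  shows "\<kappa>\<^sup>2 * W \<le> L * n"
proof -
  define V where "V z = (\<Sum>x\<in>X. w x * dyadic_kernel R N x z)" for z
  have [measurable]: "V \<in> borel_measurable \<mu>" unfolding V_def by measurable
  have V0: "0 \<le> V z" for z
    unfolding V_def using w dyadic_kernel_nonneg by (intro sum_nonneg mult_nonneg_nonneg)
  have W0: "0 \<le> W" unfolding assms using w by (intro sum_nonneg) auto
  \<comment> \<open>With this parameter the energy term in Young's inequality is half of the left-hand side.\<close>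
  define a where "a = L / \<kappa>"
  have a: "0 < a" using assms by (simp add: a_def)
  have "ennreal (W * \<kappa>) = (\<Sum>x\<in>X. ennreal (w x) * ennreal \<kappa>)"
    using w \<open>0 < \<kappa>\<close> by (simp add: assms(8) sum_distrib_right sum_ennreal flip: ennreal_mult')
  also have "\<dots> \<le> (\<Sum>x\<in>X. ennreal (w x) * (\<integral>\<^sup>+z. ennreal (dyadic_kernel R N x z * f z) \<partial>\<mu>))"
    by (intro sum_mono mult_left_mono pot) auto
  also have "\<dots> = (\<integral>\<^sup>+z. (\<Sum>x\<in>X. ennreal (w x) * ennreal (dyadic_kernel R N x z * f z)) \<partial>\<mu>)"
    by (subst nn_integral_sum) (auto simp: nn_integral_cmult)
  also have "\<dots> = (\<integral>\<^sup>+z. ennreal (V z * f z) \<partial>\<mu>)"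
  proof (intro nn_integral_cong)
    fix z
    have "(\<Sum>x\<in>X. ennreal (w x) * ennreal (dyadic_kernel R N x z * f z))
        = (\<Sum>x\<in>X. ennreal (w x * (dyadic_kernel R N x z * f z)))"
      using w by (simp add: ennreal_mult')
    also have "\<dots> = ennreal (\<Sum>x\<in>X. w x * (dyadic_kernel R N x z * f z))"
      using w f dyadic_kernel_nonneg by (intro sum_ennreal mult_nonneg_nonneg)
    also have "(\<Sum>x\<in>X. w x * (dyadic_kernel R N x z * f z)) = V z * f z"
      by (simp add: V_def sum_distrib_right mult.assoc)
    finally show "(\<Sum>x\<in>X. ennreal (w x) * ennreal (dyadic_kernel R N x z * f z)) = ennreal (V z * f z)" .
  qed
  also have "\<dots> \<le> (\<integral>\<^sup>+z. ennreal (a / 2) * ennreal ((f z)\<^sup>2) + ennreal (1 / (2 * a)) * ennreal ((V z)\<^sup>2) \<partial>\<mu>)"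
  proof (rule nn_integral_mono)
    fix z
    have "0 \<le> (a * f z - V z)\<^sup>2" by simp
    then have "V z * f z \<le> a / 2 * (f z)\<^sup>2 + 1 / (2 * a) * (V z)\<^sup>2"
      using a by (simp add: field_simps power2_eq_square)
    then show "ennreal (V z * f z)
        \<le> ennreal (a / 2) * ennreal ((f z)\<^sup>2) + ennreal (1 / (2 * a)) * ennreal ((V z)\<^sup>2)"
      using a by (simp add: ennreal_leI flip: ennreal_mult' ennreal_plus)
  qed
  also have "\<dots> = ennreal (a / 2) * (\<integral>\<^sup>+z. ennreal ((f z)\<^sup>2) \<partial>\<mu>)
      + ennreal (1 / (2 * a)) * (\<integral>\<^sup>+z. ennreal ((V z)\<^sup>2) \<partial>\<mu>)"
    by (subst nn_integral_add) (auto simp: nn_integral_cmult)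
  also have "\<dots> \<le> ennreal (a / 2) * ennreal n + ennreal (1 / (2 * a)) * ennreal (L * W)"
    using norm energy unfolding V_def by (intro add_mono mult_left_mono) auto
  also have "\<dots> = ennreal (a / 2 * n + 1 / (2 * a) * (L * W))"
    using a assms W0 by (simp flip: ennreal_mult' ennreal_plus)
  finally have "W * \<kappa> \<le> a / 2 * n + 1 / (2 * a) * (L * W)"
    using a assms W0 by (subst (asm) ennreal_le_iff) auto
  also have "1 / (2 * a) * (L * W) = W * \<kappa> / 2"
    using \<open>0 < L\<close> \<open>0 < \<kappa>\<close> by (simp add: a_def)
  finally have "W * \<kappa> \<le> a * n" by simp
  then have "W * \<kappa> * \<kappa> \<le> a * n * \<kappa>" using \<open>0 < \<kappa>\<close> by (intro mult_right_mono) auto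
  also have "a * n * \<kappa> = L * n" using \<open>0 < \<kappa>\<close> by (simp add: a_def)
  finally show ?thesis by (simp add: power2_eq_square mult_ac)
qed

text \<open>
  Duality bounds the mass \<open>W\<close> by \<open>n\<close> times the sum of the ball masses.  Only the scales from \<open>J\<close>
  on obey the growth bound by \<open>h\<close>; at each of the finitely many coarser scales the mass is at most
  \<open>W\<close> itself, and the smallness of \<open>n\<close> allows that contribution to be absorbed.
\<close>
lemma frostman_mass_le:
  fixes f w :: "'a \<Rightarrow> real"
  assumes "d = 4" and f: "f \<in> borel_measurable \<mu>" "\<And>y. 0 \<le> f y"
    and "finite X" and w: "\<And>x. 0 \<le> w x" and "0 < R" and "0 < \<kappa>"
    and h0: "\<And>j. 0 \<le> h (R * (1/2) ^ j)" and sum_h: "\<And>k. (\<Sum>j<k. h (R * (1/2) ^ j)) \<le> H" and "0 < H"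
    and frostman: "\<And>x j. x \<in> X \<Longrightarrow> J \<le> j \<Longrightarrow> j \<le> N \<Longrightarrow>
            (\<Sum>y\<in>X \<inter> ball x (R * (1/2) ^ j). w y) \<le> h (R * (1/2) ^ j)"
    and pot: "\<And>x. x \<in> X \<Longrightarrow> ennreal \<kappa> \<le> (\<integral>\<^sup>+z. ennreal (dyadic_kernel R N x z * f z) \<partial>\<mu>)"
    and norm: "(\<integral>\<^sup>+z. ennreal ((f z)\<^sup>2) \<partial>\<mu>) \<le> ennreal n" and "0 \<le> n"
    and n: "8 / 3 * C * R ^ 4 * real (Suc J) * n \<le> \<kappa>\<^sup>2 / 2"
  shows "(\<Sum>x\<in>X. w x) \<le> 16 / 3 * C * R ^ 4 * H / \<kappa>\<^sup>2 * n"
proof -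
  define W where "W = (\<Sum>x\<in>X. w x)"
  define Q where "Q = 8 / 3 * C * R ^ 4"
  define m where "m j = (if j \<le> J then W else h (R * (1/2) ^ (j - 1)))" for j
  have Q: "0 < Q" using C_pos \<open>0 < R\<close> by (simp add: Q_def)
  have W0: "0 \<le> W" unfolding W_def using w by (intro sum_nonneg) auto
  have m0: "0 \<le> m j" for j using W0 h0 by (simp add: m_def)
  have m: "(\<Sum>y\<in>X \<inter> ball x (2 * (R * (1/2) ^ j)). w y) \<le> m j" if "x \<in> X" "j \<le> N" for x j
  proof (cases "j \<le> J")
    case True
    have "(\<Sum>y\<in>X \<inter> ball x (2 * (R * (1/2) ^ j)). w y) \<le> W"
      unfolding W_def using w \<open>finite X\<close> by (intro sum_mono2) auto
    with True show ?thesis by (simp add: m_def)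
  next
    case False
    then obtain i where i: "j = Suc i" by (cases j) auto
    have "2 * (R * (1/2) ^ j) = R * (1/2) ^ i" by (simp add: i)
    then show ?thesis using frostman[OF that(1), of i] False that(2) by (simp add: m_def i)
  qed
  have "(\<Sum>j\<le>N. m j) \<le> real (Suc J) * W + H"
  proof -
    have "(\<Sum>j\<le>N. m j) = m 0 + (\<Sum>i<N. m (Suc i))"
      unfolding lessThan_Suc_atMost[symmetric] by (rule sum.lessThan_Suc_shift)
    also have "m 0 = W" by (simp add: m_def)
    also have "(\<Sum>i<N. m (Suc i)) \<le> (\<Sum>i<N. (if i \<in> {..<J} then W else 0) + h (R * (1/2) ^ i))"
      using W0 h0 by (intro sum_mono) (auto simp: m_def)
    also have "\<dots> = (\<Sum>i\<in>{..<N} \<inter> {..<J}. W) + (\<Sum>i<N. h (R * (1/2) ^ i))"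
      by (simp only: sum.distrib sum.inter_restrict[OF finite_lessThan])
    also have "(\<Sum>i\<in>{..<N} \<inter> {..<J}. W) \<le> (\<Sum>i<J. W)"
      using W0 by (intro sum_mono2) auto
    finally show ?thesis using sum_h[of N] by (simp add: algebra_simps)
  qed
  then have m_sum: "Q * W * (\<Sum>j\<le>N. m j) \<le> Q * W * (real (Suc J) * W + H)"
    using Q W0 by (intro mult_left_mono) auto
  have "(\<integral>\<^sup>+z. ennreal ((\<Sum>x\<in>X. w x * dyadic_kernel R N x z)\<^sup>2) \<partial>\<mu>)
      \<le> ennreal (Q * W * (\<Sum>j\<le>N. m j))"
    unfolding Q_def W_def by (rule dyadic_energy_le[OF \<open>d = 4\<close> \<open>finite X\<close> w \<open>0 < R\<close> m0 m])
  also have "\<dots> \<le> ennreal (Q * W * (real (Suc J) * W + H))"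
    by (rule ennreal_leI[OF m_sum])
  also have "Q * W * (real (Suc J) * W + H) = Q * (real (Suc J) * W + H) * W" by simp
  finally have "(\<integral>\<^sup>+z. ennreal ((\<Sum>x\<in>X. w x * dyadic_kernel R N x z)\<^sup>2) \<partial>\<mu>)
      \<le> ennreal (Q * (real (Suc J) * W + H) * W)" .
  moreover have "0 < real (Suc J) * W + H" using W0 \<open>0 < H\<close> by (intro add_nonneg_pos) auto
  ultimately have "\<kappa>\<^sup>2 * W \<le> Q * (real (Suc J) * W + H) * n"
    using Q assms by (intro dyadic_potential_duality[OF f \<open>finite X\<close> w _ _ _ W_def pot norm]) auto
  also have "\<dots> = (Q * real (Suc J) * n) * W + Q * H * n" by (simp add: algebra_simps)
  also have "\<dots> \<le> \<kappa>\<^sup>2 / 2 * W + Q * H * n"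
    using n W0 unfolding Q_def by (intro add_right_mono mult_right_mono) auto
  finally have "\<kappa>\<^sup>2 * W \<le> 2 * Q * H * n" by (simp add: field_simps)
  then have "W \<le> 2 * Q * H * n / \<kappa>\<^sup>2" using \<open>0 < \<kappa>\<close> by (simp add: field_simps)
  then show ?thesis by (simp add: W_def Q_def)
qed

text \<open>
  Saturating the constraints \<open>\<nu>(B(x, r\<^sub>j)) \<le> h(r\<^sub>j)\<close> on a fine net of \<open>K\<close> makes every
  net point lie in a ball with \<open>\<nu>(B) = h(r)\<close>.  Disjoint tight balls whose enlargements cover
  \<open>K\<close> show, by the doubling property of \<open>h\<close>, that the premeasure of \<open>K\<close> is at most a constant
  times the mass of \<open>\<nu>\<close>; and this mass is small by duality.  The largest radius admitted depends
  on \<open>\<delta>\<close> alone, so that all constants are fixed before \<open>f\<close> is chosen.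
\<close>
lemma hausdorff_premeasure_null_critical:
  fixes h :: "real \<Rightarrow> real"
  assumes "d = 4" and h: "hausdorff_function h" and "log_stieltjes_integral h < \<infinity>"
    and "bounded (UNIV :: 'a set)" and "0 < c" and "0 < \<delta>" and "compact K"
    and small: "\<And>e. 0 < e \<Longrightarrow> \<exists>f\<in>borel_measurable \<mu>. (\<forall>y. 0 \<le> f y) \<and>
            (\<integral>\<^sup>+y. ennreal ((f y)\<^sup>2) \<partial>\<mu>) < ennreal e \<and>
            (\<forall>x\<in>K. 1 \<le> ennreal c * (\<integral>\<^sup>+y. riesz_bound 4 (dist x y) * ennreal (f y) \<partial>\<mu>))"
  shows "hausdorff_premeasure h \<delta> K = 0"
proof -
  obtain x0 :: 'a and e0 where e0: "\<And>y. dist x0 y \<le> e0"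
    using \<open>bounded UNIV\<close> unfolding bounded_def by blast
  obtain M :: nat where M: "2 * e0 < 2 ^ M" using real_arch_pow[of 2 "2 * e0"] by auto
  define R :: real where "R = 2 ^ M"
  have R: "0 < R" by (simp add: R_def)
  have diam: "dist x y < R" for x y :: 'a
    using dist_triangle3[of x y x0] e0[of x] e0[of y] M by (simp add: R_def)
  have hmono: "mono_on {0..} h" and hpos: "\<And>r. 0 < r \<Longrightarrow> 0 < h r"
    using h by (auto simp: hausdorff_function_def)
  obtain D where D: "1 < D" "\<And>r. 0 < r \<Longrightarrow> h (2 * r) \<le> D * h r"
    using h by (auto simp: hausdorff_function_def)
  have dbl: "h (8 * r) \<le> D ^ 3 * h r" if "0 < r" for r
  proof -
    have "h (8 * r) \<le> D * h (4 * r)" using D(2)[of "4 * r"] that by simp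
    also have "\<dots> \<le> D * (D * h (2 * r))" using D(2)[of "2 * r"] D(1) that by (intro mult_left_mono) auto
    also have "\<dots> \<le> D * (D * (D * h r))" using D(2)[of r] D(1) that by (intro mult_left_mono) auto
    finally show ?thesis by (simp add: power3_eq_cube mult.assoc)
  qed
  define r where "r j = R * (1/2) ^ j" for j :: nat
  have r0: "0 < r j" for j using R by (simp add: r_def)
  have r_dec: "r l \<le> r j" if "j \<le> l" for j l
    using that R by (auto simp: r_def intro!: mult_left_mono power_decreasing)
  have "summable (\<lambda>j. h (r j))"
  proof -
    have "summable (\<lambda>j. h ((1/2) ^ j))" by (rule hausdorff_function_dyadic_summable) fact+
    moreover have "r (j + M) = (1/2) ^ j" for j
      by (simp add: r_def R_def power_add flip: power_mult_distrib)
    ultimately show ?thesis using summable_iff_shift[of "\<lambda>j. h (r j)" M] by simp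
  qed
  define H where "H = (\<Sum>j. h (r j))"
  have sum_h: "(\<Sum>j<k. h (r j)) \<le> H" for k
    unfolding H_def using \<open>summable _\<close> hpos[OF r0] by (intro sum_le_suminf) (auto intro: less_imp_le)
  have H: "0 < H" using sum_h[of 1] hpos[OF r0[of 0]] by simp
  define \<kappa> where "\<kappa> = R\<^sup>2 / (40 * c)"
  have \<kappa>: "0 < \<kappa>" using R \<open>0 < c\<close> by (simp add: \<kappa>_def)
  obtain J where "(1/2::real) ^ J < \<delta> / (8 * R)"
    using real_arch_pow_inv[of "\<delta> / (8 * R)" "1/2"] R \<open>0 < \<delta>\<close> by auto
  then have J: "8 * r J < \<delta>" using R by (simp add: r_def field_simps)
  define A where "A = D ^ 3 * (16 / 3 * C * R ^ 4 * H / \<kappa>\<^sup>2)"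
  have A: "0 < A" using D(1) C_pos R H \<kappa> by (simp add: A_def)
  have "hausdorff_premeasure h \<delta> K \<le> 0 + ennreal e" if "0 < e" for e
  proof -
    define n where "n = min (e / A) (\<kappa>\<^sup>2 / 2 / (8 / 3 * C * R ^ 4 * real (Suc J)))"
    have P: "0 < 8 / 3 * C * R ^ 4 * real (Suc J)" using C_pos R by simp
    then have n: "0 < n" using that A \<kappa> unfolding n_def by (simp add: zero_less_divide_iff)
    have n2: "8 / 3 * C * R ^ 4 * real (Suc J) * n \<le> \<kappa>\<^sup>2 / 2"
    proof -
      have "n \<le> \<kappa>\<^sup>2 / 2 / (8 / 3 * C * R ^ 4 * real (Suc J))" by (simp add: n_def)
      then show ?thesis using P by (subst (asm) pos_le_divide_eq) (auto simp: mult_ac)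
    qed
    have n1: "A * n \<le> e"
    proof -
      have "n \<le> e / A" by (simp add: n_def)
      then show ?thesis using A by (simp add: field_simps)
    qed
    obtain f where f: "f \<in> borel_measurable \<mu>" "\<And>y. 0 \<le> f y"
      and norm: "(\<integral>\<^sup>+y. ennreal ((f y)\<^sup>2) \<partial>\<mu>) < ennreal n"
      and fK: "\<And>x. x \<in> K \<Longrightarrow> 1 \<le> ennreal c * (\<integral>\<^sup>+y. riesz_bound 4 (dist x y) * ennreal (f y) \<partial>\<mu>)"
      using small[OF n] by blast
    obtain N0 where N0: "\<And>N x. N0 \<le> N \<Longrightarrow> x \<in> K \<Longrightarrow>
        ennreal \<kappa> \<le> (\<integral>\<^sup>+y. ennreal (dyadic_kernel R N x y * f y) \<partial>\<mu>)"
      using compact_uniform_dyadic_potential[OF f \<open>0 < c\<close> diam \<open>compact K\<close> fK] unfolding \<kappa>_def by blast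
    define N where "N = max J N0"
    obtain X where X: "X \<subseteq> K" "finite X" "K \<subseteq> (\<Union>x\<in>X. ball x (r N))"
      using compact_finite_ball_subcover[OF \<open>compact K\<close>, of "\<lambda>_. r N"] r0 by blast
    define \<B> where "\<B> = X \<times> {J..N}"
    define U where "U = (\<lambda>(x::'a, j). ball x (r j))"
    have "\<exists>w. (\<forall>x. 0 \<le> w x) \<and>
           (\<forall>b\<in>\<B>. (\<Sum>x\<in>X \<inter> U b. w x) \<le> h (r (snd b))) \<and>
           (\<forall>x\<in>X. \<exists>b\<in>\<B>. x \<in> U b \<and> (\<Sum>x\<in>X \<inter> U b. w x) = h (r (snd b)))"
    proof (rule saturating_weights[OF \<open>finite X\<close>])
      show "finite \<B>" using X(2) by (simp add: \<B>_def)
      show "0 \<le> h (r (snd b))" for b using hpos[OF r0] by (rule less_imp_le)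
      show "X \<subseteq> (\<Union>b\<in>\<B>. U b)"
      proof
        fix x assume "x \<in> X"
        then have "(x, J) \<in> \<B>" by (simp add: \<B>_def N_def)
        moreover have "x \<in> U (x, J)" by (simp add: U_def r0)
        ultimately show "x \<in> (\<Union>b\<in>\<B>. U b)" by blast
      qed
    qed
    then obtain w where w: "\<And>x. 0 \<le> w x"
      and frostman: "\<And>b. b \<in> \<B> \<Longrightarrow> (\<Sum>x\<in>X \<inter> U b. w x) \<le> h (r (snd b))"
      and tight: "\<And>x. x \<in> X \<Longrightarrow> \<exists>b\<in>\<B>. x \<in> U b \<and> (\<Sum>x\<in>X \<inter> U b. w x) = h (r (snd b))" by blast
    have mass: "(\<Sum>x\<in>X. w x) \<le> 16 / 3 * C * R ^ 4 * H / \<kappa>\<^sup>2 * n"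
    proof (rule frostman_mass_le[OF \<open>d = 4\<close> f X(2) w R \<kappa>, of h])
      show "0 \<le> h (R * (1/2) ^ j)" for j using hpos[OF r0, of j] by (simp add: r_def)
      show "(\<Sum>j<k. h (R * (1/2) ^ j)) \<le> H" for k using sum_h[of k] by (simp add: r_def)
      show "(\<Sum>y\<in>X \<inter> ball x (R * (1/2) ^ j). w y) \<le> h (R * (1/2) ^ j)"
        if "x \<in> X" "J \<le> j" "j \<le> N" for x j
        using frostman[of "(x, j)"] that by (simp add: \<B>_def U_def r_def)
      show "ennreal \<kappa> \<le> (\<integral>\<^sup>+z. ennreal (dyadic_kernel R N x z * f z) \<partial>\<mu>)" if "x \<in> X" for x
        using N0[of N x] that X(1) by (auto simp: N_def)
    qed (use norm n n2 H in auto)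
    define T where "T = {b \<in> \<B>. (\<Sum>x\<in>X \<inter> U b. w x) = h (r (snd b))}"
    have "finite T" using X(2) by (simp add: T_def \<B>_def)
    have U_eq: "U b = ball (fst b) (r (snd b))" for b by (simp add: U_def split: prod.split)
    obtain S where S: "S \<subseteq> T" "disjoint_family_on U S"
      and cover: "(\<Union>b\<in>T. U b) \<subseteq> (\<Union>b\<in>S. ball (fst b) (3 * r (snd b)))"
      using finite_Vitali_covering[OF \<open>finite T\<close>, of fst "\<lambda>b. r (snd b)"]
      unfolding U_eq by blast
    have finS: "finite S" using S(1) \<open>finite T\<close> finite_subset by blast
    have "hausdorff_premeasure h \<delta> K \<le> (\<Sum>b\<in>S. ennreal (h (2 * (4 * r (snd b)))))"
    proof (rule hausdorff_premeasure_ball_cover[OF finS _ _ _ hmono])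
      show "K \<subseteq> (\<Union>b\<in>S. ball (fst b) (4 * r (snd b)))"
      \<comment> \<open>A point of \<open>K\<close> is within \<open>r N\<close> of the net, which enlarges the factor 3 of the Vitali cover to 4.\<close>
      proof
        fix y assume "y \<in> K"
        then obtain x where x: "x \<in> X" "dist x y < r N" using X(3) by auto
        obtain b' where "b' \<in> \<B>" "x \<in> U b'" "(\<Sum>x\<in>X \<inter> U b'. w x) = h (r (snd b'))"
          using tight[OF x(1)] by blast
        then have "b' \<in> T" by (simp add: T_def)
        with \<open>x \<in> U b'\<close> have "x \<in> (\<Union>b\<in>T. U b)" by blast
        then obtain b where b: "b \<in> S" "dist (fst b) x < 3 * r (snd b)" using cover by auto
        have "snd b \<le> N" using b(1) S(1) by (auto simp: T_def \<B>_def)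
        then have "dist (fst b) y < 4 * r (snd b)"
          using dist_triangle[of "fst b" y x] b(2) x(2) r_dec[of "snd b" N] by linarith
        with b(1) show "y \<in> (\<Union>b\<in>S. ball (fst b) (4 * r (snd b)))" by auto
      qed
      show "0 \<le> 4 * r (snd b)" for b using r0[of "snd b"] by simp
      show "2 * (4 * r (snd b)) < \<delta>" if "b \<in> S" for b
      proof -
        have "J \<le> snd b" using that S(1) by (auto simp: T_def \<B>_def)
        then show ?thesis using r_dec[of J "snd b"] J by linarith
      qed
    qed
    also have "\<dots> \<le> (\<Sum>b\<in>S. ennreal (D ^ 3 * (\<Sum>x\<in>X \<inter> U b. w x)))"
    proof (intro sum_mono ennreal_leI)
      fix b assume "b \<in> S"
      then have "(\<Sum>x\<in>X \<inter> U b. w x) = h (r (snd b))" using S(1) by (auto simp: T_def)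
      then show "h (2 * (4 * r (snd b))) \<le> D ^ 3 * (\<Sum>x\<in>X \<inter> U b. w x)"
        using dbl[OF r0[of "snd b"]] by simp
    qed
    also have "\<dots> = ennreal (D ^ 3 * (\<Sum>b\<in>S. \<Sum>x\<in>X \<inter> U b. w x))"
      using D(1) w by (simp add: sum_ennreal sum_nonneg sum_distrib_left)
    also have "(\<Sum>b\<in>S. \<Sum>x\<in>X \<inter> U b. w x) = (\<Sum>x\<in>(\<Union>b\<in>S. X \<inter> U b). w x)"
    proof (rule sum.UNION_disjoint[symmetric])
      show "\<forall>b\<in>S. \<forall>b'\<in>S. b \<noteq> b' \<longrightarrow> (X \<inter> U b) \<inter> (X \<inter> U b') = {}"
        using S(2) unfolding disjoint_family_on_def by blast
    qed (use finS X(2) in auto)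
    also have "\<dots> \<le> (\<Sum>x\<in>X. w x)"
      using X(2) w by (intro sum_mono2) auto
    also have "\<dots> \<le> 16 / 3 * C * R ^ 4 * H / \<kappa>\<^sup>2 * n" by (rule mass)
    finally have "hausdorff_premeasure h \<delta> K \<le> ennreal (D ^ 3 * (16 / 3 * C * R ^ 4 * H / \<kappa>\<^sup>2 * n))"
      using D(1) by (simp add: ennreal_leI mult_left_mono)
    also have "D ^ 3 * (16 / 3 * C * R ^ 4 * H / \<kappa>\<^sup>2 * n) = A * n" by (simp add: A_def)
    also have "\<dots> \<le> e" by (rule n1)
    finally show ?thesis by (simp add: ennreal_leI)
  qed
  then have "hausdorff_premeasure h \<delta> K \<le> 0" by (rule ennreal_le_epsilon)
  then show ?thesis by simp
qed

end

section \<open>Null sets of the capacity\<close>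

lemma Cap2_eq_0_imp_small_potential:
  fixes \<mu> :: "'a::{metric_space, second_countable_topology} measure"
  assumes "sets \<mu> = sets borel" and "0 < p"
    and cap: "Cap2 \<mu> P lam p S = 0" and "0 < c" and "0 < e"
    and kernel: "\<And>x y. resolvent_density \<mu> P lam x y \<le> ennreal c * riesz_bound d (dist x y)"
  shows "\<exists>f\<in>borel_measurable \<mu>. (\<forall>y. 0 \<le> f y) \<and>
     (\<integral>\<^sup>+y. ennreal (f y powr p) \<partial>\<mu>) < ennreal e \<and>
     (\<forall>x\<in>S. 1 \<le> ennreal c * (\<integral>\<^sup>+y. riesz_bound d (dist x y) * ennreal (f y) \<partial>\<mu>))"
proof -
  note [measurable_cong] = assms(1)
  have "Cap2 \<mu> P lam p S < ennreal e" using cap \<open>0 < e\<close> by simp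
  then obtain g where g: "g \<in> Lp_space \<mu> p" "\<And>x. x \<in> S \<Longrightarrow> 1 \<le> resolvent \<mu> P lam g x"
    "ennreal (Lp_norm \<mu> p g powr p) < ennreal e"
    unfolding Cap2_def INF_less_iff by blast
  have [measurable]: "g \<in> borel_measurable \<mu>" and int: "integrable \<mu> (\<lambda>x. \<bar>g x\<bar> powr p)"
    using g(1) by (auto simp: Lp_space_def)
  have "(\<integral>\<^sup>+y. ennreal (\<bar>g y\<bar> powr p) \<partial>\<mu>) = ennreal (\<integral>y. \<bar>g y\<bar> powr p \<partial>\<mu>)"
    by (rule nn_integral_eq_integral[OF int]) simp
  also have "(\<integral>y. \<bar>g y\<bar> powr p \<partial>\<mu>) = Lp_norm \<mu> p g powr p"
    using \<open>0 < p\<close> by (simp add: Lp_norm_def powr_powr)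
  finally have norm: "(\<integral>\<^sup>+y. ennreal (\<bar>g y\<bar> powr p) \<partial>\<mu>) < ennreal e" using g(3) by simp
  have pot: "1 \<le> ennreal c * (\<integral>\<^sup>+y. riesz_bound d (dist x y) * ennreal \<bar>g y\<bar> \<partial>\<mu>)" if "x \<in> S" for x
  proof -
    have "1 \<le> (\<integral>\<^sup>+y. resolvent_density \<mu> P lam x y * ennreal (g y) \<partial>\<mu>)"
      using g(2)[OF that] by (simp add: resolvent_def)
    also have "\<dots> \<le> (\<integral>\<^sup>+y. (ennreal c * riesz_bound d (dist x y)) * ennreal \<bar>g y\<bar> \<partial>\<mu>)"
      by (intro nn_integral_mono mult_mono kernel ennreal_leI) auto
    also have "\<dots> = ennreal c * (\<integral>\<^sup>+y. riesz_bound d (dist x y) * ennreal \<bar>g y\<bar> \<partial>\<mu>)"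
      by (subst nn_integral_cmult[symmetric], measurable) (simp add: mult.assoc)
    finally show ?thesis .
  qed
  show ?thesis
    by (rule bexI[of _ "\<lambda>y. \<bar>g y\<bar>"]) (use norm pot in auto)
qed

theorem lemma5:
  fixes \<mu> :: "'a::{metric_space, second_countable_topology} measure"
    and D :: "('a \<Rightarrow> real) set"
    and A :: "('a \<Rightarrow> real) \<Rightarrow> ('a \<Rightarrow> real)"
    and P :: "real \<Rightarrow> ('a \<Rightarrow> real) \<Rightarrow> ('a \<Rightarrow> real)"
    and lam d c6 c7 :: real
    and \<Sigma> :: "'a set"
  assumes "locally compact (UNIV :: 'a set)"
    and "radon_measure \<mu>" and "full_support \<mu>"
    and "self_adjoint_operator \<mu> D A" and "nonpositive_operator \<mu> D A"
    and "dirichlet_form \<mu> (form_domain \<mu> D A) (quadratic_form \<mu> D A)"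
    and "regular_form \<mu> (form_domain \<mu> D A) (quadratic_form \<mu> D A)"
    and "strongly_local_form \<mu> (form_domain \<mu> D A) (quadratic_form \<mu> D A)"
    and "admits_carre_du_champ \<mu> (form_domain \<mu> D A) (quadratic_form \<mu> D A)"
    and "symmetric_markov_semigroup \<mu> P" and "semigroup_generator \<mu> P D A"
    and "lam > 0"
    and "complete (UNIV :: 'a set)"
    and "strong_feller \<mu> P" and "absolutely_continuous_semigroup \<mu> P"
    and "d > 0" and "c6 > 0" and "c7 > 0"
    and "\<And>x y. resolvent_density \<mu> P lam x y \<le> ennreal c6 * riesz_bound d (dist x y)"
    and "\<And>x r. r > 0 \<Longrightarrow> emeasure \<mu> (ball x r) \<le> ennreal (c7 * r powr d)"
    and "closed \<Sigma>"
  shows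
    "(d > 4 \<longrightarrow> (\<forall>\<epsilon>>0. Cap2 \<mu> P lam 2 \<Sigma> = 0 \<longrightarrow> hausdorff_measure_dim (d - 4 + \<epsilon>) \<Sigma> = 0))
     \<and> (d = 4 \<and> bounded (UNIV :: 'a set) \<longrightarrow>
          (\<forall>h. hausdorff_function h \<and> log_stieltjes_integral h < \<infinity> \<longrightarrow>
             Cap2 \<mu> P lam 2 \<Sigma> = 0 \<longrightarrow> hausdorff_measure h \<Sigma> = 0))
     \<and> (\<forall>p \<epsilon>. 1 < p \<and> d > 2 * p \<and> \<epsilon> > 0 \<and>
             (p \<noteq> 2 \<longrightarrow> (\<forall>x. \<forall>r>0. emeasure \<mu> (ball x r) \<ge> ennreal (1 / c7 * r powr d))) \<longrightarrow>
             Cap2 \<mu> P lam p \<Sigma> = 0 \<longrightarrow> hausdorff_measure_dim (d - 2 * p + \<epsilon>) \<Sigma> = 0)"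
proof -
  have sets: "sets \<mu> = sets borel" using assms(2) by (simp add: radon_measure_def)
  interpret upper_regular_measure \<mu> d c7
    by unfold_locales (use sets assms in auto)
  note small = Cap2_eq_0_imp_small_potential[OF sets _ _ assms(17) _ assms(19), where S = \<Sigma>]
  have subcritical: "hausdorff_measure_dim (d - 2 * p + \<epsilon>) \<Sigma> = 0"
    if p: "1 < p" "2 * p < d" and "0 < \<epsilon>" and cap: "Cap2 \<mu> P lam p \<Sigma> = 0" for p \<epsilon>
  proof -
    have "hausdorff_measure (\<lambda>r. r powr (d - 2 * p + \<epsilon>)) \<Sigma> = 0"
    proof (rule hausdorff_measure_null_if_compact_subsets_null[OF assms(1) \<open>closed \<Sigma>\<close>])
      fix K :: "'a set" and \<delta> :: real
      assume K: "compact K" "K \<subseteq> \<Sigma>" "\<delta> > 0"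
      show "hausdorff_premeasure (\<lambda>r. r powr (d - 2 * p + \<epsilon>)) \<delta> K = 0"
      proof (rule hausdorff_premeasure_null_subcritical[OF _ p(2) _ assms(17) K(3,1)])
        show "\<exists>f\<in>borel_measurable \<mu>. (\<forall>y. 0 \<le> f y) \<and>
            (\<integral>\<^sup>+y. ennreal (f y powr p) \<partial>\<mu>) < ennreal e \<and>
            (\<forall>x\<in>K. 1 \<le> ennreal c6 * (\<integral>\<^sup>+y. riesz_bound d (dist x y) * ennreal (f y) \<partial>\<mu>))"
          if "0 < e" for e
        proof -
          have "0 < p" using p by simp
          from small[OF this cap that] K(2) show ?thesis by blast
        qed
      qed (use p \<open>0 < \<epsilon>\<close> in auto)
    qed
    moreover have "d - 2 * p + \<epsilon> \<noteq> 0" using p \<open>0 < \<epsilon>\<close> by linarith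
    ultimately show ?thesis by (simp add: hausdorff_measure_dim_def)
  qed
  have critical: "hausdorff_measure h \<Sigma> = 0"
    if d: "d = 4" and bdd: "bounded (UNIV :: 'a set)" and h: "hausdorff_function h" "log_stieltjes_integral h < \<infinity>"
      and cap: "Cap2 \<mu> P lam 2 \<Sigma> = 0" for h
  proof (rule hausdorff_measure_null_if_compact_subsets_null[OF assms(1) \<open>closed \<Sigma>\<close>])
    fix K :: "'a set" and \<delta> :: real
    assume K: "compact K" "K \<subseteq> \<Sigma>" "\<delta> > 0"
    show "hausdorff_premeasure h \<delta> K = 0"
    proof (rule hausdorff_premeasure_null_critical[OF d h bdd assms(17) K(3,1)])
      show "\<exists>f\<in>borel_measurable \<mu>. (\<forall>y. 0 \<le> f y) \<and>
          (\<integral>\<^sup>+y. ennreal ((f y)\<^sup>2) \<partial>\<mu>) < ennreal e \<and>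
          (\<forall>x\<in>K. 1 \<le> ennreal c6 * (\<integral>\<^sup>+y. riesz_bound 4 (dist x y) * ennreal (f y) \<partial>\<mu>))"
        if "0 < e" for e
      proof -
        have "0 < (2::real)" by simp
        from small[OF this cap that] obtain f
          where f: "f \<in> borel_measurable \<mu>" "\<forall>y. 0 \<le> f y"
          "(\<integral>\<^sup>+y. ennreal (f y powr 2) \<partial>\<mu>) < ennreal e"
          "\<forall>x\<in>\<Sigma>. 1 \<le> ennreal c6 * (\<integral>\<^sup>+y. riesz_bound d (dist x y) * ennreal (f y) \<partial>\<mu>)"
          by blast
        have "f y powr 2 = (f y)\<^sup>2" for y using f(2) by simp
        with f K(2) d show ?thesis by (intro bexI[of _ f]) auto
      qed
    qed
  qed
  show ?thesis
  proof (intro conjI allI impI; (elim conjE)?)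
    show "hausdorff_measure_dim (d - 4 + \<epsilon>) \<Sigma> = 0"
      if "4 < d" "0 < \<epsilon>" "Cap2 \<mu> P lam 2 \<Sigma> = 0" for \<epsilon>
      using subcritical[of 2 \<epsilon>] that by simp
  qed (rule critical subcritical; assumption)+
qed

end
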